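(* Let $\beta>0$, $\beta\ne1$, $0<c<1$, $\lambda>0$, and put $\eta=1+\lambda\left(1-\frac1c\right)^2$. Let $\{S_n\}_{n\ge0}$ be the sequence of polynomials orthogonal with respect to $$(f,g)_S=\sum_{k=0}^{+\infty}f(k)g(k)\frac{c^k(\beta)_k}{k!}+\lambda\sum_{k=0}^{+\infty}\Delta f(k)\,\Delta g(k)\frac{c^k(\beta)_k}{k!},$$ normalized by the condition that the leading coefficient of $S_n$ equals that of the Meixner polynomial $m_n(x;\beta,c)$, namely $\frac1{n!}\left(1-\frac1c\right)^n$. Let $\{q_n(\eta)\}_{n\ge0}$ be defined by $q_0(\eta)=q_1(\eta)=1$ and $$(n+\beta-1)\,q_{n+1}(\eta)=(n+\beta-1+\eta c n)\,q_n(\eta)-c\,n\,q_{n-1}(\eta),\qquad n\ge1 .$$ Set $$a=\frac{1+\eta c-\sqrt{(1+\eta c)^2-4c}}{2c},\qquad \gamma=\frac{a-a^2c}{1-a^2c},\qquad \delta=\frac{1-a}{1-a^2c}.$$ Then, for all $x$ and all $\omega$ with $|\omega|<ac<1$, $$\sum_{n=0}^{+\infty}q_n(\eta)S_n(x)\omega^n=\frac{1}{1-\omega}(1-ca\omega)^{-(\beta-1)\delta}\left(1-\frac{\omega}{a}\right)^{-(\beta-1)\gamma}\left(1-\frac{\omega}{ac}\right)^{x}\left(1-\frac{\omega}{a}\right)^{-x}\;{}_2F_1\!\left(-x,(\beta-1)\delta;\beta-1;\frac{\omega(c-1)(1-a^2c)}{(1-ca\omega)(ac-\omega)}\right).$$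
   Context: $\Delta f(k)=f(k+1)-f(k)$ is the forward difference operator; $(\beta)_0=1$, $(\beta)_k=\beta(\beta+1)\cdots(\beta+k-1)$ is the Pochhammer symbol. The polynomials $S_n$ have degree exactly $n$ and satisfy $(S_n,S_m)_S=0$ for $n\neq m$. The Meixner polynomials are $m_n(x;\beta,c)=\sum_{k=0}^{n}\frac{(\beta+k)_{n-k}}{k!\,(n-k)!}(-x)_k\left(\frac1c-1\right)^k$. ${}_2F_1(A,B;C;z)$ denotes the Gauss hypergeometric function, given by $\sum_{k\ge0}\frac{(A)_k(B)_k}{(C)_k}\frac{z^k}{k!}$ for $|z|<1$ and by its principal analytic continuation to $\mathbb{C}\setminus[1,+\infty)$ otherwise. The variables $x$ and $\omega$ may be taken complex, and powers are principal branches (all bases have positive real part when $|\omega|<ac$). *)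

theory Defs
  imports "HOL-Analysis.Analysis" "HOL-Computational_Algebra.Polynomial"
begin

definition fwd_diff :: "(real \<Rightarrow> real) \<Rightarrow> real \<Rightarrow> real" where
  "fwd_diff f x = f (x + 1) - f x"

definition meixner_weight :: "real \<Rightarrow> real \<Rightarrow> nat \<Rightarrow> real" where
  "meixner_weight \<beta> c k = c ^ k * pochhammer \<beta> k / fact k"

definition sobolev_ip ::
  "real \<Rightarrow> real \<Rightarrow> real \<Rightarrow> (real \<Rightarrow> real) \<Rightarrow> (real \<Rightarrow> real) \<Rightarrow> real" where
  "sobolev_ip \<beta> c lam f g =
     (\<Sum>k. f (real k) * g (real k) * meixner_weight \<beta> c k) +
     lam * (\<Sum>k. fwd_diff f (real k) * fwd_diff g (real k) * meixner_weight \<beta> c k)"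

(* [:0, -1:] is the polynomial -x, so its pochhammer symbol is (-x)_k as a polynomial in x. *)
definition meixner :: "real \<Rightarrow> real \<Rightarrow> nat \<Rightarrow> real poly" where
  "meixner \<beta> c n =
     (\<Sum>k\<le>n. smult (pochhammer (\<beta> + real k) (n - k) / (fact k * fact (n - k)) * (1 / c - 1) ^ k)
        (pochhammer [:0, -1:] k))"

lemma degree_lead_coeff_pochhammer_neg_X:
  "degree (pochhammer [:0, -1 :: real:] k) = k \<and>
   lead_coeff (pochhammer [:0, -1 :: real:] k) = (-1) ^ k"
proof (induction k)
  case 0
  show ?case by simp
next
  case (Suc k)
  have lin: "[:0, -1:] + of_nat k = ([:real k, -1:] :: real poly)"
    by (simp add: of_nat_poly)
  have nz: "pochhammer [:0, -1 :: real:] k \<noteq> 0"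
    using Suc by (metis leading_coeff_0_iff power_eq_0_iff zero_neq_neg_one)
  have d: "degree (pochhammer [:0, -1 :: real:] (Suc k)) = Suc k"
    using Suc nz by (simp add: pochhammer_Suc lin degree_mult_eq del: mult_pCons_right)
  have "lead_coeff (pochhammer [:0, -1 :: real:] (Suc k)) = (-1) ^ k * lead_coeff [:real k, -1:]"
    using Suc by (metis pochhammer_Suc lin lead_coeff_mult)
  with d show ?case by simp
qed

lemma degree_lead_coeff_meixner:
  assumes "0 < c" "c < 1"
  shows "degree (meixner \<beta> c n) = n"
    and "lead_coeff (meixner \<beta> c n) = (1 - 1 / c) ^ n / fact n"
proof -
  have deg: "degree (pochhammer [:0, -1 :: real:] k) = k" for k
    using degree_lead_coeff_pochhammer_neg_X by blast
  have lc: "coeff (pochhammer [:0, -1 :: real:] k) k = (-1) ^ k" for k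
    using degree_lead_coeff_pochhammer_neg_X[of k] by metis
  have le: "degree (meixner \<beta> c n) \<le> n"
    unfolding meixner_def
    by (rule degree_sum_le) (auto intro: order.trans[OF degree_smult_le] simp: deg)
  have "coeff (meixner \<beta> c n) n =
      (\<Sum>k\<le>n. if k = n then (1 / c - 1) ^ n / fact n * (-1) ^ n else 0)"
    unfolding meixner_def coeff_sum
    by (rule sum.cong) (auto simp: lc coeff_eq_0 deg)
  also have "\<dots> = ((1 / c - 1) * (-1)) ^ n / fact n"
    by (simp only: power_mult_distrib sum.delta finite_atMost atMost_iff order_refl if_True times_divide_eq_left)
  also have "(1 / c - 1) * (-1) = 1 - 1 / c"
    by simp
  finally have co: "coeff (meixner \<beta> c n) n = (1 - 1 / c) ^ n / fact n" .
  have "1 - 1 / c \<noteq> 0" using assms by auto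
  then have "coeff (meixner \<beta> c n) n \<noteq> 0" unfolding co by (simp del: right_minus_eq)
  with le show d: "degree (meixner \<beta> c n) = n"
    by (simp add: le_antisym le_degree)
  show "lead_coeff (meixner \<beta> c n) = (1 - 1 / c) ^ n / fact n"
    by (simp add: d co)
qed

(* Gauss' series; meaningful when C is not in {0, -1, -2, ...}. *)
definition hyp2F1_series :: "complex \<Rightarrow> complex \<Rightarrow> complex \<Rightarrow> complex \<Rightarrow> complex" where
  "hyp2F1_series A B C z =
     (\<Sum>k. pochhammer A k * pochhammer B k / pochhammer C k * (z ^ k / fact k))"

definition slit_plane :: "complex set" where
  "slit_plane = UNIV - complex_of_real ` {1..}"

(* The slit plane is connected and contains the unit disc, so the values of such an F on it are
   uniquely determined; nothing is said about hyp2F1 on the cut itself. *)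
definition hyp2F1 :: "complex \<Rightarrow> complex \<Rightarrow> complex \<Rightarrow> complex \<Rightarrow> complex" where
  "hyp2F1 A B C =
     (SOME F. F holomorphic_on slit_plane \<and> (\<forall>z. norm z < 1 \<longrightarrow> F z = hyp2F1_series A B C z))"

end

theory Submission
  imports Defs "HOL-Complex_Analysis.Complex_Analysis"
begin

text \<open>
  Put \<open>R\<^sub>n = m\<^sub>n(x; \<beta> - 1, c)\<close>. Since \<open>R\<^sub>n = m\<^sub>n - m\<^sub>n\<^sub>-\<^sub>1\<close> and \<open>\<Delta>R\<^sub>n = (1 - 1/c) m\<^sub>n\<^sub>-\<^sub>1\<close>,
  the polynomial \<open>R\<^sub>n\<close> is Sobolev-orthogonal to all polynomials of degree less than \<open>n - 1\<close>, so
  \<open>S\<^sub>n = R\<^sub>n + d S\<^sub>n\<^sub>-\<^sub>1\<close>; comparing norms gives \<open>d = q\<^sub>n\<^sub>-\<^sub>1 / q\<^sub>n\<close>, that is,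
  \<open>q\<^sub>n S\<^sub>n = q\<^sub>0 R\<^sub>0 + \<dots> + q\<^sub>n R\<^sub>n\<close>. This accounts for the factor \<open>1 / (1 - \<omega>)\<close>.

  The recurrence for \<open>q\<^sub>n\<close> says that \<open>P(t) = \<Sum> (\<beta> - 1)\<^sub>n q\<^sub>n t\<^sup>n / n!\<close> satisfies a first order linear
  differential equation, whence \<open>P(t) = (1 - t/a)\<^sup>-\<^sup>A (1 - a c t)\<^sup>-\<^sup>B\<close> with \<open>A = (\<beta> - 1) \<gamma>\<close> and
  \<open>B = (\<beta> - 1) \<delta>\<close>. Inserting the explicit form of \<open>R\<^sub>n\<close> turns \<open>\<Sum> q\<^sub>n R\<^sub>n \<omega>\<^sup>n\<close> into a combination of the
  Taylor coefficients of \<open>s \<mapsto> P(\<omega> + s)\<close>, which is resummed as an identity of formal power series.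

  Finally the right-hand side is holomorphic for \<open>|\<omega>| < a c\<close>: the argument of the hypergeometric
  function has real part less than 1 there. Hence its Taylor series converges on that disc.
\<close>

unbundle no vec_syntax

section \<open>Binomial series and the formal identity\<close>

text \<open>The expansion of \<open>(1 - \<alpha> X)\<^sup>-\<^sup>A\<close>.\<close>

definition fps_negpow :: "'a::field_char_0 \<Rightarrow> 'a \<Rightarrow> 'a fps" where
  "fps_negpow A \<alpha> = Abs_fps (\<lambda>n. pochhammer A n / fact n * \<alpha> ^ n)"

lemma fps_negpow_nth [simp]: "fps_negpow A \<alpha> $ n = pochhammer A n / fact n * \<alpha> ^ n"
  by (simp add: fps_negpow_def)

lemma pochhammer_Vandermonde_fact:
  fixes a b :: "'a::field_char_0"
  shows "pochhammer (a + b) n / fact n =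
    (\<Sum>k\<le>n. (pochhammer a k / fact k) * (pochhammer b (n - k) / fact (n - k)))"
proof -
  have "pochhammer (a + b) n / fact n =
    (\<Sum>k\<le>n. of_nat (n choose k) * pochhammer a k * pochhammer b (n - k) / fact n)"
    by (simp add: pochhammer_binomial_sum sum_divide_distrib)
  also have "\<dots> = (\<Sum>k\<le>n. (pochhammer a k / fact k) * (pochhammer b (n - k) / fact (n - k)))"
    by (rule sum.cong) (auto simp: binomial_fact field_simps)
  finally show ?thesis .
qed

lemma fps_negpow_add: "fps_negpow (A + B) \<alpha> = fps_negpow A \<alpha> * fps_negpow B \<alpha>"
proof (rule fps_ext)
  fix n
  have "(fps_negpow A \<alpha> * fps_negpow B \<alpha>) $ n =
    (\<Sum>k\<le>n. (pochhammer A k / fact k) * (pochhammer B (n - k) / fact (n - k))) * \<alpha> ^ n"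
    unfolding fps_mult_nth atLeast0AtMost sum_distrib_right
    by (rule sum.cong) (auto simp: power_add [symmetric] mult_ac)
  then show "fps_negpow (A + B) \<alpha> $ n = (fps_negpow A \<alpha> * fps_negpow B \<alpha>) $ n"
    unfolding fps_negpow_nth pochhammer_Vandermonde_fact by simp
qed

lemma fps_negpow_0 [simp]: "fps_negpow 0 \<alpha> = 1"
  by (rule fps_ext) (auto simp: pochhammer_0_left)

lemma fps_negpow_of_nat: "fps_negpow (of_nat j) \<alpha> = fps_negpow 1 \<alpha> ^ j"
  by (induction j) (simp_all add: fps_negpow_add)

lemma fps_negpow_1_times: "fps_negpow 1 \<alpha> * (1 - fps_const \<alpha> * fps_X) = 1"
proof -
  have "fps_negpow 1 \<alpha> $ n = \<alpha> ^ n" for n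
    by (simp add: pochhammer_fact [symmetric])
  moreover have "(F * (1 - fps_const \<alpha> * fps_X)) $ n = F $ n - (if n = 0 then 0 else \<alpha> * F $ (n - 1))"
    for F :: "'a fps" and n
    by (simp add: right_diff_distrib mult.left_commute [of F])
  ultimately show ?thesis
    by (intro fps_ext) (simp flip: power_Suc del: fps_negpow_nth)
qed

lemma fps_deriv_negpow:
  "fps_deriv (fps_negpow A \<alpha>) = fps_const (A * \<alpha>) * fps_negpow (A + 1) \<alpha>"
proof (rule fps_ext)
  fix n
  have "of_nat (Suc n) / fact (Suc n) = (1 / fact n :: 'a)"
    by (simp add: field_simps del: of_nat_Suc)
  then have "of_nat (Suc n) * (pochhammer A (Suc n) / fact (Suc n) * \<alpha> ^ Suc n)
    = A * \<alpha> * (pochhammer (A + 1) n / fact n * \<alpha> ^ n)"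
    unfolding pochhammer_rec by (simp add: field_simps del: of_nat_Suc fact_Suc)
  then show "fps_deriv (fps_negpow A \<alpha>) $ n = (fps_const (A * \<alpha>) * fps_negpow (A + 1) \<alpha>) $ n"
    by simp
qed

text \<open>It evaluates the difference \<open>v - u\<close> that arises in
  \<open>fps_binomial_transform_negpow_mult\<close>.\<close>

lemma fps_negpow_partial_fraction:
  "fps_const (b - \<alpha>) * (fps_negpow 1 b * fps_negpow 1 \<alpha>) =
    fps_const b * fps_negpow 1 b - fps_const \<alpha> * fps_negpow 1 \<alpha>" (is "?c * (?B * ?A) = _")
proof -
  have "?c * (?B * ?A) = fps_const b * ?B * (?A * (1 - fps_const \<alpha> * fps_X))
      - fps_const \<alpha> * ?A * (?B * (1 - fps_const b * fps_X))"
    by (simp add: algebra_simps flip: fps_const_sub)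
  then show ?thesis
    by (simp add: fps_negpow_1_times)
qed

text \<open>Write 1 - (\<alpha> + \<kappa>) X as (1 - \<alpha> X) (1 - \<kappa> X / (1 - \<alpha>
  X)) and expand the second factor. The i-th term carries X^i, so each coefficient needs only
  finitely many terms.\<close>

lemma fps_negpow_shift_nth:
  "(M * fps_negpow D (\<alpha> + \<kappa>)) $ n =
    (\<Sum>i\<le>n. pochhammer D i / fact i * \<kappa> ^ i * (fps_X ^ i * (M * fps_negpow (D + of_nat i) \<alpha>)) $ n)"
proof -
  have *: "fps_negpow D (\<alpha> + \<kappa>) $ m =
    (\<Sum>i\<le>n. pochhammer D i / fact i * \<kappa> ^ i * (fps_X ^ i * fps_negpow (D + of_nat i) \<alpha>) $ m)"
    if "m \<le> n" for m
  proof -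
    have "fps_negpow D (\<alpha> + \<kappa>) $ m =
      (\<Sum>i\<le>m. pochhammer D m / fact m * (of_nat (m choose i) * \<kappa> ^ i * \<alpha> ^ (m - i)))"
      by (simp add: binomial_ring sum_distrib_left add.commute [of \<alpha>])
    also have "\<dots> = (\<Sum>i\<le>m. pochhammer D i / fact i * \<kappa> ^ i *
        (fps_X ^ i * fps_negpow (D + of_nat i) \<alpha>) $ m)"
    proof (rule sum.cong [OF refl])
      fix i assume "i \<in> {..m}"
      then show "pochhammer D m / fact m * (of_nat (m choose i) * \<kappa> ^ i * \<alpha> ^ (m - i)) =
        pochhammer D i / fact i * \<kappa> ^ i * (fps_X ^ i * fps_negpow (D + of_nat i) \<alpha>) $ m"
        by (simp add: fps_X_power_mult_nth binomial_fact pochhammer_product [of i m D] field_simps)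
    qed
    also have "\<dots> = (\<Sum>i\<le>n. pochhammer D i / fact i * \<kappa> ^ i *
        (fps_X ^ i * fps_negpow (D + of_nat i) \<alpha>) $ m)"
      using that by (intro sum.mono_neutral_left) (auto simp: fps_X_power_mult_nth)
    finally show ?thesis .
  qed
  have "(M * fps_negpow D (\<alpha> + \<kappa>)) $ n =
    (\<Sum>l\<le>n. \<Sum>i\<le>n. pochhammer D i / fact i * \<kappa> ^ i *
      (M $ l * (fps_X ^ i * fps_negpow (D + of_nat i) \<alpha>) $ (n - l)))"
    unfolding fps_mult_nth [of M] atLeast0AtMost
    by (intro sum.cong refl) (simp add: * sum_distrib_left mult_ac del: fps_negpow_nth)
  also have "\<dots> = (\<Sum>i\<le>n. pochhammer D i / fact i * \<kappa> ^ i *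
      (M * (fps_X ^ i * fps_negpow (D + of_nat i) \<alpha>)) $ n)"
    unfolding fps_mult_nth [of M] atLeast0AtMost sum_distrib_left by (rule sum.swap)
  finally show ?thesis
    by (simp add: mult_ac)
qed

section \<open>Binomial transforms of power series\<close>

lemma fps_const_sum: "fps_const (sum f I) = (\<Sum>i\<in>I. fps_const (f i))"
  by (rule fps_ext) (simp add: fps_sum_nth)

text \<open>This is X^k / k! times the k-th derivative of \<open>F\<close>, that is, the coefficient
  of s^k in F(X + s X). The explicit Meixner sum leads to combinations of such transforms.\<close>

definition fps_binomial_transform :: "nat \<Rightarrow> 'a::field_char_0 fps \<Rightarrow> 'a fps" where
  "fps_binomial_transform k F = Abs_fps (\<lambda>n. of_nat (n choose k) * F $ n)"

text \<open>The Leibniz rule; on coefficients it is the Vandermonde identity for n choose k with n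
  split as i + (n - i).\<close>

lemma fps_binomial_transform_mult:
  "fps_binomial_transform k (F * G) =
    (\<Sum>r\<le>k. fps_binomial_transform r F * fps_binomial_transform (k - r) G)"
proof (rule fps_ext)
  fix n
  have "fps_binomial_transform k (F * G) $ n = (\<Sum>i\<le>n. of_nat (n choose k) * (F $ i * G $ (n - i)))"
    by (simp add: fps_binomial_transform_def fps_mult_nth atLeast0AtMost sum_distrib_left)
  also have "\<dots> = (\<Sum>i\<le>n. \<Sum>r\<le>k. of_nat (i choose r) * F $ i *
      (of_nat (n - i choose (k - r)) * G $ (n - i)))"
  proof (rule sum.cong [OF refl])
    fix i assume "i \<in> {..n}"
    then have "n choose k = (\<Sum>r\<le>k. (i choose r) * (n - i choose (k - r)))"
      using vandermonde [of i "n - i" k] by simp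
    then show "of_nat (n choose k) * (F $ i * G $ (n - i)) =
      (\<Sum>r\<le>k. of_nat (i choose r) * F $ i * (of_nat (n - i choose (k - r)) * G $ (n - i)))"
      by (simp add: sum_distrib_right sum_distrib_left mult_ac)
  qed
  also have "\<dots> = (\<Sum>r\<le>k. fps_binomial_transform r F * fps_binomial_transform (k - r) G) $ n"
    unfolding fps_sum_nth fps_mult_nth atLeast0AtMost fps_binomial_transform_def
    by (subst sum.swap) simp
  finally show "fps_binomial_transform k (F * G) $ n =
    (\<Sum>r\<le>k. fps_binomial_transform r F * fps_binomial_transform (k - r) G) $ n" .
qed

text \<open>The shift of the exponent from A to A + r is written as the r-th power of \<alpha> / (1
  - \<alpha> X), so that the Leibniz sum takes the shape of
  \<open>negpow_product_rearrange\<close>.\<close>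

lemma fps_binomial_transform_negpow:
  "fps_binomial_transform r (fps_negpow A \<alpha>) =
    fps_const (pochhammer A r / fact r) * fps_X ^ r * fps_negpow A \<alpha> *
      (fps_const \<alpha> * fps_negpow 1 \<alpha>) ^ r"
proof -
  have "fps_binomial_transform r (fps_negpow A \<alpha>) =
    fps_const (pochhammer A r / fact r * \<alpha> ^ r) * fps_X ^ r * fps_negpow (A + of_nat r) \<alpha>"
  proof (rule fps_ext)
    fix n
    show "fps_binomial_transform r (fps_negpow A \<alpha>) $ n =
      (fps_const (pochhammer A r / fact r * \<alpha> ^ r) * fps_X ^ r * fps_negpow (A + of_nat r) \<alpha>) $ n"
    proof (cases "r \<le> n")
      case True
      then have "\<alpha> ^ n = \<alpha> ^ r * \<alpha> ^ (n - r)"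
        by (simp flip: power_add)
      with True show ?thesis
        by (simp add: fps_binomial_transform_def mult.assoc fps_X_power_mult_nth binomial_fact
            pochhammer_product [OF True] field_simps)
    qed (simp add: fps_binomial_transform_def mult.assoc fps_X_power_mult_nth)
  qed
  then show ?thesis
    by (simp add: fps_negpow_add fps_negpow_of_nat power_mult_distrib fps_const_power mult_ac
        flip: fps_const_mult)
qed

(* Comparison of the s^k-coefficients of (1 - u s)^(-A) (1 - v s)^(-B) and of its rewriting as
   (1 - u s)^(-A-B) (1 - (v - u) s / (1 - u s))^(-B). *)
lemma negpow_product_rearrange:
  fixes u v :: "'a::field_char_0 fps"
  shows "(\<Sum>r\<le>k. fps_const (pochhammer A r / fact r) * u ^ r *
            (fps_const (pochhammer B (k - r) / fact (k - r)) * v ^ (k - r))) =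
    (\<Sum>j\<le>k. fps_const (pochhammer B j / fact j * (pochhammer (A + B + of_nat j) (k - j) / fact (k - j)))
            * (v - u) ^ j * u ^ (k - j))"
proof -
  define h where "h j i l = pochhammer B j / fact j *
      ((pochhammer A l / fact l) * (pochhammer (B + of_nat j) i / fact i))" for i j l
  have "(\<Sum>r\<le>k. fps_const (pochhammer A r / fact r) * u ^ r *
            (fps_const (pochhammer B (k - r) / fact (k - r)) * v ^ (k - r))) =
    (\<Sum>m\<le>k. fps_const (pochhammer A (k - m) / fact (k - m)) * u ^ (k - m) *
            (fps_const (pochhammer B m / fact m) * v ^ m))"
    by (rule sum.reindex_bij_witness [of _ "\<lambda>m. k - m" "\<lambda>m. k - m"]) auto
  also have "\<dots> = (\<Sum>m\<le>k. \<Sum>j\<le>m. fps_const (h j (m - j) (k - m)) * (v - u) ^ j * u ^ (k - j))"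
  proof (rule sum.cong [OF refl])
    fix m assume m: "m \<in> {..k}"
    have "v ^ m = ((v - u) + u) ^ m" by simp
    also have "\<dots> = (\<Sum>j\<le>m. of_nat (m choose j) * (v - u) ^ j * u ^ (m - j))"
      by (rule binomial_ring)
    finally have vm: "v ^ m = (\<Sum>j\<le>m. fps_const (of_nat (m choose j)) * (v - u) ^ j * u ^ (m - j))"
      by (simp add: fps_of_nat)
    show "fps_const (pochhammer A (k - m) / fact (k - m)) * u ^ (k - m) *
            (fps_const (pochhammer B m / fact m) * v ^ m) =
      (\<Sum>j\<le>m. fps_const (h j (m - j) (k - m)) * (v - u) ^ j * u ^ (k - j))"
      unfolding vm sum_distrib_left
    proof (rule sum.cong [OF refl])
      fix j assume j: "j \<in> {..m}"
      have 1: "u ^ (k - j) = u ^ (k - m) * u ^ (m - j)"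
        using m j by (simp flip: power_add)
      have "h j (m - j) (k - m) =
        pochhammer A (k - m) / fact (k - m) * (pochhammer B m / fact m) * of_nat (m choose j)"
        using j by (simp add: h_def binomial_fact pochhammer_product [of j m B] field_simps)
      then show "fps_const (pochhammer A (k - m) / fact (k - m)) * u ^ (k - m) *
          (fps_const (pochhammer B m / fact m) *
            (fps_const (of_nat (m choose j)) * (v - u) ^ j * u ^ (m - j))) =
          fps_const (h j (m - j) (k - m)) * (v - u) ^ j * u ^ (k - j)"
        unfolding 1 by (simp only: fps_const_mult [symmetric] mult_ac)
    qed
  qed
  also have "\<dots> = (\<Sum>j\<le>k. \<Sum>m=j..k. fps_const (h j (m - j) (k - m)) * (v - u) ^ j * u ^ (k - j))"
    unfolding sum.Sigma [OF finite_atMost ballI [OF finite_atMost]]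
      sum.Sigma [OF finite_atMost ballI [OF finite_atLeastAtMost]]
    by (rule sum.reindex_bij_witness [of _ prod.swap prod.swap]) auto
  also have "\<dots> = (\<Sum>j\<le>k. fps_const (\<Sum>m=j..k. h j (m - j) (k - m)) * (v - u) ^ j * u ^ (k - j))"
    by (simp add: sum_distrib_right fps_const_sum)
  also have "\<dots> = (\<Sum>j\<le>k. fps_const (pochhammer B j / fact j *
     (pochhammer (A + B + of_nat j) (k - j) / fact (k - j))) * (v - u) ^ j * u ^ (k - j))"
  proof (rule sum.cong [OF refl])
    fix j assume "j \<in> {..k}"
    \<comment> \<open>For fixed j the sum over m is a Vandermonde convolution of the parameters A
      and B + j.\<close>
    then have "(\<Sum>m=j..k. h j (m - j) (k - m)) = (\<Sum>i\<le>k - j. h j i (k - j - i))"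
      by (intro sum.reindex_bij_witness [of _ "\<lambda>i. i + j" "\<lambda>m. m - j"]) auto
    also have "\<dots> = pochhammer B j / fact j *
        (pochhammer ((B + of_nat j) + A) (k - j) / fact (k - j))"
      unfolding pochhammer_Vandermonde_fact [of "B + of_nat j" A "k - j"] h_def sum_distrib_left
      by (simp only: mult_ac)
    finally show "fps_const (\<Sum>m=j..k. h j (m - j) (k - m)) * (v - u) ^ j * u ^ (k - j) =
      fps_const (pochhammer B j / fact j *
       (pochhammer (A + B + of_nat j) (k - j) / fact (k - j))) * (v - u) ^ j * u ^ (k - j)"
      by (simp add: add_ac)
  qed
  finally show ?thesis .
qed

text \<open>The Leibniz rule, followed by the rearrangement with u = \<alpha> / (1 - \<alpha> X) and
  v = b / (1 - b X). The gain is the factor (A + B + j)_(k - j), which later cancels against the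
  denominator (C)_k.\<close>

lemma fps_binomial_transform_negpow_mult:
  "fps_binomial_transform k (fps_negpow A \<alpha> * fps_negpow B b) =
    (\<Sum>j\<le>k. fps_const (pochhammer B j / fact j * (pochhammer (A + B + of_nat j) (k - j) / fact (k - j))
            * (b - \<alpha>) ^ j * \<alpha> ^ (k - j)) * (fps_X ^ k *
          (fps_negpow (B + of_nat j) b * fps_negpow (A + of_nat k) \<alpha>)))"
proof -
  define u where "u = fps_const \<alpha> * fps_negpow 1 \<alpha>"
  define v where "v = fps_const b * fps_negpow 1 b"
  have vu: "v - u = fps_const (b - \<alpha>) * (fps_negpow 1 b * fps_negpow 1 \<alpha>)"
    by (simp only: u_def v_def fps_negpow_partial_fraction)
  have "fps_binomial_transform k (fps_negpow A \<alpha> * fps_negpow B b) =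
    fps_X ^ k * fps_negpow A \<alpha> * fps_negpow B b *
    (\<Sum>r\<le>k. fps_const (pochhammer A r / fact r) * u ^ r *
            (fps_const (pochhammer B (k - r) / fact (k - r)) * v ^ (k - r)))"
    unfolding fps_binomial_transform_mult fps_binomial_transform_negpow
      u_def [symmetric] v_def [symmetric] sum_distrib_left
  proof (rule sum.cong [OF refl])
    fix r assume "r \<in> {..k}"
    then have "fps_X ^ k = fps_X ^ r * (fps_X ^ (k - r) :: 'a fps)"
      by (simp flip: power_add)
    then show "fps_const (pochhammer A r / fact r) * fps_X ^ r * fps_negpow A \<alpha> * u ^ r *
      (fps_const (pochhammer B (k - r) / fact (k - r)) * fps_X ^ (k - r) * fps_negpow B b * v ^ (k - r)) =
      fps_X ^ k * fps_negpow A \<alpha> * fps_negpow B b *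
      (fps_const (pochhammer A r / fact r) * u ^ r *
      (fps_const (pochhammer B (k - r) / fact (k - r)) * v ^ (k - r)))"
      by (simp only: mult_ac)
  qed
  also have "\<dots> = (\<Sum>j\<le>k. fps_X ^ k * fps_negpow A \<alpha> * fps_negpow B b *
      (fps_const (pochhammer B j / fact j * (pochhammer (A + B + of_nat j) (k - j) / fact (k - j)))
            * (v - u) ^ j * u ^ (k - j)))"
    by (simp only: negpow_product_rearrange sum_distrib_left)
  also have "\<dots> = (\<Sum>j\<le>k. fps_const (pochhammer B j / fact j * (pochhammer (A + B + of_nat j) (k - j) / fact (k - j))
            * (b - \<alpha>) ^ j * \<alpha> ^ (k - j)) * (fps_X ^ k *
          (fps_negpow (B + of_nat j) b * fps_negpow (A + of_nat k) \<alpha>)))"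
  proof (rule sum.cong [OF refl])
    fix j assume j: "j \<in> {..k}"
    have 1: "fps_negpow 1 \<alpha> ^ k = fps_negpow 1 \<alpha> ^ j * fps_negpow 1 \<alpha> ^ (k - j)"
      using j by (simp flip: power_add)
    show "fps_X ^ k * fps_negpow A \<alpha> * fps_negpow B b *
      (fps_const (pochhammer B j / fact j * (pochhammer (A + B + of_nat j) (k - j) / fact (k - j)))
            * (v - u) ^ j * u ^ (k - j)) =
      fps_const (pochhammer B j / fact j * (pochhammer (A + B + of_nat j) (k - j) / fact (k - j))
            * (b - \<alpha>) ^ j * \<alpha> ^ (k - j)) * (fps_X ^ k *
          (fps_negpow (B + of_nat j) b * fps_negpow (A + of_nat k) \<alpha>))"
      unfolding vu fps_negpow_add fps_negpow_of_nat 1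
      by (simp only: u_def power_mult_distrib fps_const_power fps_const_mult [symmetric] mult_ac)
  qed
  finally show ?thesis .
qed

text \<open>Without constant term in \<open>Z\<close>, Z^j does not reach the n-th coefficient for j
  > n.\<close>

lemma fps_mult_compose_nth:
  fixes F Z H :: "'a::field_char_0 fps"
  assumes "Z $ 0 = 0"
  shows "(H * (F oo Z)) $ n = (\<Sum>j\<le>n. F $ j * (H * Z ^ j) $ n)"
proof -
  have "(F oo Z) $ m = (\<Sum>j\<le>n. F $ j * (Z ^ j) $ m)" if "m \<le> n" for m
    unfolding fps_compose_nth atLeast0AtMost using that assms
    by (intro sum.mono_neutral_left) (auto simp: startsby_zero_power_prefix)
  then have "(H * (F oo Z)) $ n = (\<Sum>i\<le>n. \<Sum>j\<le>n. F $ j * (H $ i * (Z ^ j) $ (n - i)))"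
    unfolding fps_mult_nth atLeast0AtMost
    by (intro sum.cong refl) (simp add: sum_distrib_left mult_ac)
  also have "\<dots> = (\<Sum>j\<le>n. F $ j * (H * Z ^ j) $ n)"
    unfolding fps_mult_nth atLeast0AtMost sum_distrib_left by (rule sum.swap)
  finally show ?thesis .
qed

section \<open>The formal Gauss series and the formal generating function\<close>

definition fps_hyp2F1 :: "'a::field_char_0 \<Rightarrow> 'a \<Rightarrow> 'a \<Rightarrow> 'a fps" where
  "fps_hyp2F1 A B C = Abs_fps (\<lambda>k. pochhammer A k * pochhammer B k / pochhammer C k / fact k)"

lemma fps_hyp2F1_nth [simp]:
  "fps_hyp2F1 A B C $ k = pochhammer A k * pochhammer B k / pochhammer C k / fact k"
  by (simp add: fps_hyp2F1_def)

text \<open>In the application y = -x and \<kappa> = 1/c - 1. For k = i + j, (C)_k = (C)_j (C + j)_i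
  cancels and (y)_k = (y)_j (y + j)_i splits. The sum over i rebuilds a power of 1 - (\<alpha> +
  \<alpha> \<kappa>) X by \<open>fps_negpow_shift_nth\<close>, and the sum over j is the Gauss
  series.\<close>

theorem formal_generating_function:
  fixes A B C \<alpha> b \<kappa> y :: "'a::field_char_0"
  assumes C: "\<And>k. pochhammer C k \<noteq> 0" and AB: "A + B = C"
  shows "Abs_fps (\<lambda>n. (\<Sum>k\<le>n. of_nat (n choose k) * (pochhammer y k / pochhammer C k * \<kappa> ^ k)) *
        (fps_negpow A \<alpha> * fps_negpow B b) $ n) =
    fps_negpow B b * fps_negpow (A - y) \<alpha> * fps_negpow y (\<alpha> + \<alpha> * \<kappa>) *
      (fps_hyp2F1 y B C oo
        (fps_const (\<kappa> * (b - \<alpha>)) * fps_X * fps_negpow 1 b * fps_negpow 1 (\<alpha> + \<alpha> * \<kappa>)))"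
    (is "?L = ?H * (?F oo ?Z)")
proof (rule fps_ext)
  fix n
  define W where "W j i = (fps_X ^ (i + j) *
    (fps_negpow (B + of_nat j) b * fps_negpow (A + of_nat (i + j)) \<alpha>)) $ n" for i j
  define t where "t j i = pochhammer y (i + j) / pochhammer C (i + j) * \<kappa> ^ (i + j) *
    (pochhammer B j / fact j * (pochhammer (C + of_nat j) i / fact i) * (b - \<alpha>) ^ j * \<alpha> ^ i) * W j i" for i j
  have W0: "W j i = 0" if "i + j > n" for i j
    using that by (simp add: W_def fps_X_power_mult_nth)
  have t0: "t j i = 0" if "\<not> j + i \<le> n" for i j
    using that W0 [where i = i and j = j] by (simp add: t_def)
  have "?L $ n = (\<Sum>k\<le>n. pochhammer y k / pochhammer C k * \<kappa> ^ k *
      fps_binomial_transform k (fps_negpow A \<alpha> * fps_negpow B b) $ n)"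
    by (simp add: fps_binomial_transform_def sum_distrib_right sum_distrib_left mult_ac)
  also have "\<dots> = (\<Sum>k\<le>n. \<Sum>j\<le>k. t j (k - j))"
    unfolding fps_binomial_transform_negpow_mult AB
    by (intro sum.cong refl)
      (simp add: fps_sum_nth t_def W_def sum_distrib_left mult.assoc)
  also have "\<dots> = (\<Sum>(j, i)\<in>{(j, i). j + i \<le> n}. t j i)"
    by (rule sum.triangle_reindex_eq [symmetric])
  also have "\<dots> = (\<Sum>(j, i)\<in>{..n} \<times> {..n}. t j i)"
    by (rule sum.mono_neutral_left) (auto intro!: t0)
  also have "\<dots> = (\<Sum>j\<le>n. \<Sum>i\<le>n. t j i)"
    by (rule sum.cartesian_product [symmetric])
  also have "\<dots> = (\<Sum>j\<le>n. ?F $ j * (?H * ?Z ^ j) $ n)"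
  proof (rule sum.cong [OF refl])
    fix j
    let ?c = "(\<kappa> * (b - \<alpha>)) ^ j"
    have "?H * ?Z ^ j = fps_const ?c * (fps_X ^ j *
      (fps_negpow (B + of_nat j) b * fps_negpow (A - y) \<alpha>) * fps_negpow (y + of_nat j) (\<alpha> + \<alpha> * \<kappa>))"
      by (simp only: power_mult_distrib fps_negpow_add fps_negpow_of_nat fps_const_power mult_ac)
    then have "(?H * ?Z ^ j) $ n = ?c * (\<Sum>i\<le>n. pochhammer (y + of_nat j) i / fact i * (\<alpha> * \<kappa>) ^ i *
        (fps_X ^ i * (fps_X ^ j * (fps_negpow (B + of_nat j) b * fps_negpow (A - y) \<alpha>)
          * fps_negpow (y + of_nat j + of_nat i) \<alpha>)) $ n)"
      by (simp only: fps_mult_left_const_nth fps_negpow_shift_nth)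
    also have "\<dots> = ?c * (\<Sum>i\<le>n. pochhammer (y + of_nat j) i / fact i * (\<alpha> * \<kappa>) ^ i * W j i)"
    proof -
      have "fps_X ^ i * (fps_X ^ j * (fps_negpow (B + of_nat j) b * fps_negpow (A - y) \<alpha>)
          * fps_negpow (y + of_nat j + of_nat i) \<alpha>) =
          fps_X ^ (i + j) * (fps_negpow (B + of_nat j) b * fps_negpow (A + of_nat (i + j)) \<alpha>)" for i
      proof -
        have e: "A + of_nat (i + j) = (A - y) + (y + of_nat j + of_nat i)" by simp
        show ?thesis
          by (simp only: e fps_negpow_add [of "A - y" "y + of_nat j + of_nat i"] power_add mult_ac)
      qed
      then show ?thesis
        by (simp only: W_def)
    qed
    finally have HZ: "(?H * ?Z ^ j) $ n =
      (\<Sum>i\<le>n. ?c * (pochhammer (y + of_nat j) i / fact i * (\<alpha> * \<kappa>) ^ i * W j i))"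
      by (simp add: sum_distrib_left)
    show "(\<Sum>i\<le>n. t j i) = ?F $ j * (?H * ?Z ^ j) $ n"
      unfolding HZ sum_distrib_left
    proof (rule sum.cong [OF refl])
      fix i
      have "pochhammer C j * pochhammer (C + of_nat j) i \<noteq> 0"
        using C [of "j + i"] by (simp add: pochhammer_product')
      then have "pochhammer C j \<noteq> 0" "pochhammer (C + of_nat j) i \<noteq> 0" by auto
      then show "t j i = ?F $ j * (?c * (pochhammer (y + of_nat j) i / fact i * (\<alpha> * \<kappa>) ^ i * W j i))"
        unfolding t_def add.commute [of i j] pochhammer_product' power_mult_distrib power_add fps_hyp2F1_nth
        by (simp add: mult_ac)
    qed
  qed
  also have "\<dots> = (?H * (?F oo ?Z)) $ n"
    by (rule fps_mult_compose_nth [symmetric]) simp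
  finally show "?L $ n = (?H * (?F oo ?Z)) $ n" .
qed

text \<open>The logarithmic derivative of P is A \<alpha> / (1 - \<alpha> X) + B b / (1 - b X). Over
  the common denominator its numerator is (A \<alpha> + B b) - (A + B) \<alpha> b X, and the
  hypothesis lets A + B factor out.\<close>

lemma negpow_product_ODE:
  fixes A B \<alpha> b :: "'a::field_char_0"
  assumes 1: "A * \<alpha> + B * b = A + B"
  defines "P \<equiv> fps_negpow A \<alpha> * fps_negpow B b"
  shows "fps_deriv P * (1 - fps_const (\<alpha> + b) * fps_X + fps_const (\<alpha> * b) * fps_X ^ 2) =
    fps_const (A + B) * (1 - fps_const (\<alpha> * b) * fps_X) * P"
proof -
  let ?u = "1 - fps_const \<alpha> * fps_X" and ?v = "1 - fps_const b * fps_X"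
  have "fps_deriv P * (?u * ?v) =
    P * (fps_const (A * \<alpha>) * (fps_negpow 1 \<alpha> * ?u) * ?v + fps_const (B * b) * (fps_negpow 1 b * ?v) * ?u)"
    unfolding P_def fps_deriv_mult fps_deriv_negpow fps_negpow_add
    by (simp only: distrib_left distrib_right mult_ac add.commute)
  also have "\<dots> = P * (fps_const (A * \<alpha>) * ?v + fps_const (B * b) * ?u)"
    by (simp add: fps_negpow_1_times)
  also have "fps_const (A * \<alpha>) * ?v + fps_const (B * b) * ?u =
      fps_const (A * \<alpha> + B * b) - fps_const (A + B) * (fps_const (\<alpha> * b) * fps_X)"
    by (simp add: algebra_simps flip: fps_const_add fps_const_mult)
  also have "\<dots> = fps_const (A + B) * (1 - fps_const (\<alpha> * b) * fps_X)"
    by (simp only: 1 right_diff_distrib mult_1_right)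
  also have "?u * ?v = 1 - fps_const (\<alpha> + b) * fps_X + fps_const (\<alpha> * b) * fps_X ^ 2"
    by (simp add: algebra_simps power2_eq_square flip: fps_const_add fps_const_mult)
  finally show ?thesis
    by (simp only: mult_ac)
qed

lemma negpow_product_coeff_recurrence:
  fixes A B \<alpha> b :: "'a::field_char_0"
  assumes "A * \<alpha> + B * b = A + B"
  defines "P \<equiv> fps_negpow A \<alpha> * fps_negpow B b"
  shows "of_nat (n + 2) * P $ (n + 2) =
    ((\<alpha> + b) * of_nat (n + 1) + (A + B)) * P $ (n + 1) - \<alpha> * b * (of_nat n + (A + B)) * P $ n"
proof -
  let ?D = "fps_deriv P"
  have "?D * (1 - fps_const (\<alpha> + b) * fps_X + fps_const (\<alpha> * b) * fps_X ^ 2) =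
    ?D - fps_const (\<alpha> + b) * (fps_X * ?D) + fps_const (\<alpha> * b) * (fps_X ^ 2 * ?D)"
    by (simp add: algebra_simps)
  then have "(?D - fps_const (\<alpha> + b) * (fps_X * ?D) + fps_const (\<alpha> * b) * (fps_X ^ 2 * ?D)) $ (n + 1) =
    (fps_const (A + B) * (P - fps_const (\<alpha> * b) * (fps_X * P))) $ (n + 1)"
    using negpow_product_ODE [OF assms(1)] unfolding P_def
    by (simp only: left_diff_distrib mult_1_left mult.assoc)
  moreover have "(fps_X ^ 2 * ?D) $ (n + 1) = of_nat n * P $ n"
    by (cases n) (simp_all add: fps_X_power_mult_nth)
  ultimately have "of_nat (n + 2) * P $ (n + 2) - (\<alpha> + b) * (of_nat (n + 1) * P $ (n + 1)) +
      \<alpha> * b * (of_nat n * P $ n) = (A + B) * (P $ (n + 1) - \<alpha> * b * P $ n)"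
    by simp
  then show ?thesis
    by (simp add: algebra_simps)
qed

text \<open>Both sides obey one three-term recurrence with the same first two terms; A \<alpha> + B
  b = C is the coefficient of X. The factor \<open>of_nat (Suc n) + C\<close> in \<open>rec\<close>
  is absorbed by the Pochhammer symbol, so it is never divided by.\<close>

lemma negpow_product_coeff:
  fixes A B C \<alpha> b :: "'a::field_char_0"
  assumes 1: "A * \<alpha> + B * b = C" and AB: "A + B = C"
    and q: "q 0 = 1" "q (Suc 0) = 1"
    and rec: "\<And>n. (of_nat (Suc n) + C) * q (Suc (Suc n)) =
      (C + (\<alpha> + b) * of_nat (Suc n)) * q (Suc n) - \<alpha> * b * of_nat (Suc n) * q n"
  shows "(fps_negpow A \<alpha> * fps_negpow B b) $ n = pochhammer C n / fact n * q n"
proof (induction n rule: less_induct)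
  case (less n)
  consider "n = 0" | "n = Suc 0" | m where "n = Suc (Suc m)"
    by (metis not0_implies_Suc)
  then show ?case
  proof cases
    case 3
    let ?P = "fps_negpow A \<alpha> * fps_negpow B b"
    define p where "p = pochhammer C m / fact m"
    have p1: "pochhammer C (Suc m) / fact (Suc m) = p * (C + of_nat m) / of_nat (Suc m)"
      by (simp add: p_def pochhammer_Suc field_simps)
    have p2: "pochhammer C n / fact n =
        p * (C + of_nat m) / of_nat (Suc m) * (C + of_nat (Suc m)) / of_nat n"
      by (simp add: p_def 3 pochhammer_Suc field_simps)
    have nz: "of_nat n \<noteq> (0 :: 'a)" "of_nat (Suc m) \<noteq> (0 :: 'a)"
      using 3 by (simp_all del: of_nat_Suc)
    have "?P $ Suc m = p * (C + of_nat m) / of_nat (Suc m) * q (Suc m)"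
      using less [of "Suc m"] 3 by (simp only: p1)
    moreover have "?P $ m = p * q m"
      using less [of m] 3 by (simp add: p_def)
    moreover have "of_nat n * ?P $ n =
      ((\<alpha> + b) * of_nat (Suc m) + C) * ?P $ Suc m - \<alpha> * b * (of_nat m + C) * ?P $ m"
      using negpow_product_coeff_recurrence [of A \<alpha> B b m] 1 AB 3
      by (simp del: of_nat_Suc fps_negpow_nth)
    ultimately have "of_nat n * ?P $ n = ((\<alpha> + b) * of_nat (Suc m) + C) *
      (p * (C + of_nat m) / of_nat (Suc m) * q (Suc m)) - \<alpha> * b * (C + of_nat m) * (p * q m)"
      by (simp only: add.commute)
    also have "\<dots> = p * (C + of_nat m) / of_nat (Suc m) *
      ((C + (\<alpha> + b) * of_nat (Suc m)) * q (Suc m) - \<alpha> * b * of_nat (Suc m) * q m)"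
      using nz by (simp add: divide_simps del: of_nat_Suc) (simp add: algebra_simps del: of_nat_Suc)
    also have "\<dots> = p * (C + of_nat m) / of_nat (Suc m) * ((of_nat (Suc m) + C) * q n)"
      using rec [of m] 3 by simp
    finally show ?thesis
      unfolding p2 using nz by (simp add: field_simps del: of_nat_Suc)
  qed (use q 1 in \<open>simp_all add: fps_mult_nth add.commute\<close>)
qed

section \<open>Sobolev orthogonality\<close>

text \<open>Up to the sign (-1)^n this is the n-th forward difference of the polynomial (x)_j at b.
  In the induction Pascal's rule takes out one difference, and (x)_j - (x + 1)_j = -j (x + 1)_(j -
  1) lowers the degree.\<close>

lemma alternating_binomial_sum_pochhammer:
  fixes b :: real
  assumes "j \<le> n"
  shows "(\<Sum>i\<le>n. of_nat (n choose i) * (-1) ^ i * pochhammer (b + of_nat i) j) =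
    (if j = n then (-1) ^ n * fact n else 0)"
  using assms
proof (induction n arbitrary: b j)
  case (Suc n)
  have "(\<Sum>i\<le>Suc n. of_nat (Suc n choose i) * (-1) ^ i * pochhammer (b + of_nat i) j) =
    (\<Sum>i\<le>n. of_nat (n choose i) * (-1) ^ i * (pochhammer (b + of_nat i) j - pochhammer (b + 1 + of_nat i) j))"
  proof -
    have "(\<Sum>i\<le>n. of_nat (n choose i) * (-1) ^ i * pochhammer (b + of_nat i) j) =
      (\<Sum>i\<le>Suc n. of_nat (n choose i) * (-1) ^ i * pochhammer (b + of_nat i) j)"
      by simp
    also have "\<dots> = pochhammer b j -
      (\<Sum>i\<le>n. of_nat (n choose Suc i) * (-1) ^ i * pochhammer (b + 1 + of_nat i) j)"
      by (subst sum.atMost_Suc_shift) (simp add: sum_negf add_ac)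
    finally show ?thesis
      by (subst sum.atMost_Suc_shift)
        (simp add: sum_negf add_ac algebra_simps sum.distrib sum_subtractf)
  qed
  also have "\<dots> = (\<Sum>i\<le>n. of_nat (n choose i) * (-1) ^ i *
      (- (of_nat j * pochhammer (b + 1 + of_nat i) (j - 1))))"
  proof -
    have "pochhammer x j - pochhammer (x + 1) j = - (of_nat j * pochhammer (x + 1) (j - 1))" for x :: real
    proof (cases j)
      case (Suc l)
      then show ?thesis
        using pochhammer_rec [of x l] pochhammer_rec' [of "x + 1" l] by (simp add: algebra_simps)
    qed simp
    from this [of "b + of_nat i" for i] show ?thesis
      by (simp add: add_ac)
  qed
  also have "\<dots> = - (of_nat j * (\<Sum>i\<le>n. of_nat (n choose i) * (-1) ^ i * pochhammer (b + 1 + of_nat i) (j - 1)))"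
    by (simp add: sum_negf sum_distrib_left mult_ac)
  also have "\<dots> = (if j = Suc n then (-1) ^ Suc n * fact (Suc n) else 0)"
  proof (cases j)
    case (Suc i)
    with Suc.prems have "i \<le> n" by simp
    from Suc.IH [OF this, of "b + 1"] Suc show ?thesis
      by simp
  qed simp
  finally show ?case .
qed simp

section \<open>Forward differences and contiguous relations of Meixner polynomials\<close>

definition poly_fwd_diff :: "real poly \<Rightarrow> real poly" where
  "poly_fwd_diff p = pcompose p [:1, 1:] - p"

lemma fwd_diff_poly: "fwd_diff (poly p) x = poly (poly_fwd_diff p) x"
  by (simp add: fwd_diff_def poly_fwd_diff_def poly_pcompose add_ac)

lemma poly_fwd_diff_add: "poly_fwd_diff (p + r) = poly_fwd_diff p + poly_fwd_diff r"
  by (simp add: poly_fwd_diff_def pcompose_add)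

lemma poly_fwd_diff_smult: "poly_fwd_diff (smult s p) = smult s (poly_fwd_diff p)"
  by (simp add: poly_fwd_diff_def pcompose_smult smult_diff_right)

lemma poly_fwd_diff_sum: "poly_fwd_diff (sum f I) = (\<Sum>i\<in>I. poly_fwd_diff (f i))"
  by (simp add: poly_fwd_diff_def pcompose_sum sum_subtractf)

lemma coeff_poly_fwd_diff:
  assumes "degree p \<le> n"
  shows "coeff (poly_fwd_diff p) n = 0"
proof -
  have d: "degree (pcompose p [:1, 1:]) = degree p"
    by (simp add: degree_pcompose)
  have "lead_coeff (pcompose p [:1, 1:]) = lead_coeff p * lead_coeff [:1, 1:] ^ degree p"
    by (rule lead_coeff_comp) simp
  then have "coeff (pcompose p [:1, 1:]) (degree p) = coeff p (degree p)"
    unfolding d by simp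
  then have "coeff (pcompose p [:1, 1:]) n = coeff p n"
    using assms d by (cases "n = degree p") (auto simp: coeff_eq_0)
  then show ?thesis
    by (simp add: poly_fwd_diff_def)
qed

lemma degree_poly_fwd_diff: "degree p \<le> n \<Longrightarrow> degree (poly_fwd_diff p) \<le> n"
  by (rule degree_le) (use coeff_poly_fwd_diff in auto)

lemma poly_pochhammer: "poly (pochhammer p n) x = pochhammer (poly p x) n"
  for p :: "'a::comm_ring_1 poly"
  by (induction n) (simp_all add: pochhammer_Suc)

lemma poly_fwd_diff_pochhammer:
  "poly_fwd_diff (pochhammer [:0, -1:] (Suc n)) = smult (- real (Suc n)) (pochhammer [:0, -1:] n)"
proof -
  have "poly (poly_fwd_diff (pochhammer [:0, -1:] (Suc n))) x =
    poly (smult (- real (Suc n)) (pochhammer [:0, -1:] n)) x" for x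
    using pochhammer_rec [of "- (x + 1)" n] pochhammer_rec' [of "- x" n]
    by (simp flip: fwd_diff_poly add: fwd_diff_def poly_pochhammer algebra_simps
        del: mult_minus_left)
  then show ?thesis
    by (intro poly_ext) simp
qed

lemma meixner_0 [simp]: "meixner \<beta> c 0 = 1"
  by (simp add: meixner_def)

text \<open>With r = n + 1 - k, the Pochhammer factor at (-x)_k is (\<beta> + n - r) (\<beta> +
  k)_(n - k) on the left and (\<beta> + n) (\<beta> + k)_(n - k) in m_(n+1). Their difference,
  divided by r, gives the coefficient in m_n.\<close>

lemma meixner_Suc_diff: "meixner (\<beta> - 1) c (Suc n) = meixner \<beta> c (Suc n) - meixner \<beta> c n"
proof -
  let ?m = "\<lambda>k. pochhammer [:0, -1 :: real:] k"
  have m_eq: "meixner \<beta> c n = (\<Sum>k\<le>Suc n. smult ((if k \<le> n then pochhammer (\<beta> + real k) (n - k)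
      / (fact k * fact (n - k)) else 0) * (1 / c - 1) ^ k) (?m k))"
    by (simp add: meixner_def)
  have key: "pochhammer (\<beta> - 1 + real k) (Suc n - k) / (fact k * fact (Suc n - k)) =
    pochhammer (\<beta> + real k) (Suc n - k) / (fact k * fact (Suc n - k)) -
    (if k \<le> n then pochhammer (\<beta> + real k) (n - k) / (fact k * fact (n - k)) else 0)"
    if k: "k \<le> Suc n" for k
  proof (cases "k \<le> n")
    case True
    then have e: "Suc n - k = Suc (n - k)" by simp
    define P where "P = pochhammer (\<beta> + real k) (n - k)"
    define F :: real where "F = fact k * fact (n - k)"
    define r where "r = real n - real k + 1"
    have "pochhammer (\<beta> - 1 + real k) (Suc (n - k)) = (\<beta> + real n - r) * P"
      by (simp add: P_def r_def pochhammer_rec algebra_simps)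
    moreover have "pochhammer (\<beta> + real k) (Suc (n - k)) = (\<beta> + real n) * P"
      using True by (simp add: P_def pochhammer_rec' of_nat_diff)
    moreover have "fact k * fact (Suc (n - k)) = r * F"
      using True by (simp add: r_def F_def of_nat_diff algebra_simps)
    moreover have "r > 0" "F > 0"
      using True by (simp_all add: r_def F_def)
    ultimately show ?thesis
      using True by (simp add: e diff_divide_distrib left_diff_distrib flip: F_def P_def del: fact_Suc)
  next
    case False
    with k have "k = Suc n" by simp
    then show ?thesis by simp
  qed
  show ?thesis
    unfolding meixner_def [of _ _ "Suc n"] m_eq sum_subtractf [symmetric]
      smult_diff_left [symmetric] left_diff_distrib [symmetric]
    by (rule sum.cong) (simp_all only: key atMost_iff)
qed

lemma smult_sum_right: "smult s (sum f I) = (\<Sum>i\<in>I. smult s (f i))"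
  by (induction I rule: infinite_finite_induct) (simp_all add: smult_add_right)

text \<open>The difference of (-x)_(k + 1) is -(k + 1) (-x)_k; re-indexing turns \<beta> - 1 + (k +
  1) into \<beta> + k, which is why the parameter rises by one.\<close>

lemma poly_fwd_diff_meixner:
  "poly_fwd_diff (meixner (\<beta> - 1) c (Suc n)) = smult (1 - 1 / c) (meixner \<beta> c n)"
proof -
  have "poly_fwd_diff (meixner (\<beta> - 1) c (Suc n)) =
    (\<Sum>k\<le>Suc n. smult (pochhammer (\<beta> - 1 + real k) (Suc n - k) / (fact k * fact (Suc n - k)) * (1 / c - 1) ^ k)
      (poly_fwd_diff (pochhammer [:0, -1:] k)))"
    by (simp only: meixner_def poly_fwd_diff_sum poly_fwd_diff_smult)
  also have "\<dots> = (\<Sum>k\<le>n. smult (pochhammer (\<beta> + real k) (n - k) / (fact (Suc k) * fact (n - k)) * (1 / c - 1) ^ Suc k)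
      (smult (- real (Suc k)) (pochhammer [:0, -1:] k)))"
  proof -
    have "\<beta> - 1 + real (Suc k) = \<beta> + real k" for k
      by simp
    moreover have "poly_fwd_diff 1 = 0"
      by (simp add: poly_fwd_diff_def pcompose_1)
    ultimately show ?thesis
      by (subst sum.atMost_Suc_shift)
        (simp only: poly_fwd_diff_pochhammer pochhammer_0 smult_0_right add_0_left diff_Suc_Suc)
  qed
  also have "\<dots> = smult (1 - 1 / c) (meixner \<beta> c n)"
  proof -
    have "pochhammer (\<beta> + real k) (n - k) / (fact (Suc k) * fact (n - k)) * (1 / c - 1) ^ Suc k * - real (Suc k) =
      (1 - 1 / c) * (pochhammer (\<beta> + real k) (n - k) / (fact k * fact (n - k)) * (1 / c - 1) ^ k)" for k
      by (simp add: field_simps del: of_nat_Suc)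
    then show ?thesis
      by (simp only: meixner_def smult_smult smult_sum_right)
  qed
  finally show ?thesis .
qed

section \<open>The basis of rising factorials (x + b)_j\<close>

lemma degree_lead_coeff_pochhammer_shifted:
  fixes b :: real
  shows "degree (pochhammer [:b, 1:] j) = j \<and> lead_coeff (pochhammer [:b, 1:] j) = 1"
proof (induction j)
  case (Suc j)
  have lin: "[:b, 1:] + of_nat j = [:b + real j, 1:]"
    by (simp add: of_nat_poly)
  have "pochhammer [:b, 1:] j \<noteq> 0"
    using Suc by auto
  then have "degree (pochhammer [:b, 1:] (Suc j)) = Suc j"
    using Suc by (simp add: pochhammer_Suc lin degree_mult_eq del: mult_pCons_right)
  moreover have "lead_coeff (pochhammer [:b, 1:] (Suc j)) = lead_coeff [:b + real j, 1:]"
    using Suc by (metis pochhammer_Suc lin lead_coeff_mult mult_1)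
  ultimately show ?case by simp
qed simp

lemma coeff_pochhammer_shifted:
  fixes b :: real
  assumes "j \<le> n"
  shows "coeff (pochhammer [:b, 1:] j) n = (if j = n then 1 else 0)"
  using assms degree_lead_coeff_pochhammer_shifted [of b j] by (auto simp: coeff_eq_0)

text \<open>Reduces linear statements to the basis (x + b)_j; it is used with b = \<beta>, where the
  moments have closed form. The basis case receives the bound on j because the pairing with m_n is
  evaluated only for j at most n.\<close>

lemma poly_rising_induct [consumes 1, case_names smult add]:
  fixes g :: "real poly"
  assumes "degree g \<le> n"
    and s: "\<And>a j. j \<le> n \<Longrightarrow> P (smult a (pochhammer [:b, 1:] j))"
    and a: "\<And>p r. P p \<Longrightarrow> P r \<Longrightarrow> P (p + r)"
  shows "P g"
proof -
  have "degree h \<le> m \<Longrightarrow> P h" if "m \<le> n" for h m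
    using that
  proof (induction m arbitrary: h)
    case 0
    then have "h = smult (coeff h 0) (pochhammer [:b, 1:] 0)"
      by (metis degree_0_id le_zero_eq pochhammer_0 smult_one)
    then show ?case
      using s [of 0 "coeff h 0"] 0 by simp
  next
    case (Suc m)
    let ?t = "smult (coeff h (Suc m)) (pochhammer [:b, 1:] (Suc m))"
    have "coeff (h - ?t) (Suc m) = 0"
      by (simp add: coeff_pochhammer_shifted)
    moreover have "degree (h - ?t) \<le> Suc m"
      using degree_lead_coeff_pochhammer_shifted [of b "Suc m"] Suc.prems degree_diff_le degree_smult_le
      by metis
    ultimately have "degree (h - ?t) \<le> m"
      by (metis leading_coeff_0_iff degree_0 le_SucE zero_le)
    with Suc have "P (h - ?t)" by simp
    then show ?case
      using a [of "h - ?t" ?t] s [of "Suc m" "coeff h (Suc m)"] Suc.prems by simp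
  qed
  then show ?thesis using assms(1) by blast
qed

section \<open>The Meixner functional and its moments\<close>

locale meixner_sobolev =
  fixes \<beta> c lam :: real
  assumes \<beta>: "\<beta> > 0" and c: "0 < c" "c < 1" and lam: "lam > 0"
begin

abbreviation m where "m \<equiv> meixner \<beta> c"

lemma weight_pos: "meixner_weight \<beta> c k > 0"
  using \<beta> c by (simp add: meixner_weight_def pochhammer_pos)

text \<open>The factor (-k)_i vanishes for k < i. After shifting k by i the factorials and
  Pochhammer symbols recombine to the binomial series of (1 - c)^(-(\<beta> + i + j)).\<close>

lemma weight_factorial_moment_sums:
  "(\<lambda>k. pochhammer (- real k) i * pochhammer (\<beta> + real k) j * meixner_weight \<beta> c k) sums
    ((-1) ^ i * pochhammer \<beta> (i + j) * c ^ i * (1 - c) powr (- (\<beta> + real (i + j))))" (is "?f sums ?s")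
proof -
  let ?b = "\<beta> + real (i + j)"
  have "(\<lambda>k. pochhammer b k / fact k * c ^ k) sums ((1 - c) powr (- b))" for b
  proof -
    have "(\<lambda>k. (- b gchoose k) * (- c) ^ k) sums ((1 + (- c)) powr (- b))"
      using c by (intro gen_binomial_real) auto
    then show ?thesis
      by (simp add: gbinomial_pochhammer power_minus [of c] mult_ac)
  qed
  from this [of ?b]
  have "(\<lambda>k. (-1) ^ i * pochhammer \<beta> (i + j) * c ^ i * (pochhammer ?b k / fact k * c ^ k)) sums ?s"
    by (rule sums_mult)
  also have "(\<lambda>k. (-1) ^ i * pochhammer \<beta> (i + j) * c ^ i * (pochhammer ?b k / fact k * c ^ k)) =
    (\<lambda>k. ?f (k + i))"
  proof
    fix k
    have "pochhammer (- real (k + i)) i = (-1) ^ i * pochhammer (1 + real k) i"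
      using pochhammer_minus [of "real (k + i)" i] by (simp add: add.commute)
    moreover have "fact (k + i) = fact k * pochhammer (1 + real k) i"
      using pochhammer_product' [of "1 :: real" k i] by (simp add: pochhammer_fact)
    moreover have "pochhammer (\<beta> + real (k + i)) j * pochhammer \<beta> (k + i) = pochhammer \<beta> (i + j) * pochhammer ?b k"
      using pochhammer_product' [of \<beta> "k + i" j] pochhammer_product' [of \<beta> "i + j" k]
      by (simp add: add_ac mult_ac)
    moreover have "pochhammer (1 + real k) i \<noteq> 0"
      using pochhammer_pos [of "1 + real k" i] by simp
    ultimately show "(-1) ^ i * pochhammer \<beta> (i + j) * c ^ i * (pochhammer ?b k / fact k * c ^ k) = ?f (k + i)"
      by (simp add: meixner_weight_def power_add)
  qed
  finally show ?thesis
    using sums_iff_shift [of ?f i ?s] by (simp add: pochhammer_of_nat_eq_0_lemma)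
qed

lemma summable_poly_weight: "summable (\<lambda>k. poly p (real k) * meixner_weight \<beta> c k)"
proof -
  have "degree p \<le> degree p" ..
  then show ?thesis
  proof (induction p rule: poly_rising_induct [where b = \<beta>])
    case (smult a j)
    have "summable (\<lambda>k. pochhammer (\<beta> + real k) j * meixner_weight \<beta> c k)"
      using weight_factorial_moment_sums [of 0 j] by (simp add: sums_iff)
    then show ?case
      by (simp add: poly_pochhammer mult.assoc summable_mult)
  next
    case (add p r)
    then show ?case
      by (simp add: distrib_right summable_add)
  qed
qed

definition L :: "real poly \<Rightarrow> real" where
  "L p = (\<Sum>k. poly p (real k) * meixner_weight \<beta> c k)"

lemma L_sums: "(\<lambda>k. poly p (real k) * meixner_weight \<beta> c k) sums L p"
  unfolding L_def by (rule summable_sums) (rule summable_poly_weight)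

lemma L_add: "L (p + r) = L p + L r"
  using sums_add [OF L_sums [of p] L_sums [of r]]
  by (simp add: L_def sums_iff distrib_right)

lemma L_smult: "L (smult s p) = s * L p"
  using sums_mult [OF L_sums [of p], of s] by (simp add: L_def sums_iff mult.assoc)

lemma L_diff: "L (p - r) = L p - L r"
  using L_add [of "p - r" r] by simp

lemma L_sum: "L (sum f I) = (\<Sum>i\<in>I. L (f i))"
  by (induction I rule: infinite_finite_induct) (simp_all add: L_add, simp_all add: L_def)

lemma square_weight_nonneg: "poly (p * p) x * meixner_weight \<beta> c k \<ge> 0"
  using weight_pos [of k] by simp

lemma L_square_nonneg: "L (p * p) \<ge> 0"
  unfolding L_def using summable_poly_weight square_weight_nonneg by (rule suminf_nonneg)

lemma L_square_eq_0:
  assumes "L (p * p) = 0"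
  shows "p = 0"
proof (rule ccontr)
  assume "p \<noteq> 0"
  have "poly (p * p) (real k) * meixner_weight \<beta> c k = 0" for k
    using suminf_eq_zero_iff [OF summable_poly_weight square_weight_nonneg] assms
    by (simp add: L_def)
  then have "poly p (real k) = 0" for k
    using weight_pos [of k] by (metis less_irrefl mult_eq_0_iff poly_mult)
  then have "range real \<subseteq> {x. poly p x = 0}" by auto
  then have "finite (range real)"
    using poly_roots_finite [OF \<open>p \<noteq> 0\<close>] finite_subset by blast
  then show False
    using finite_imageD [of real UNIV] by (auto simp: inj_on_def)
qed

text \<open>By \<open>L_meixner_mult\<close> this is the pairing of m_n with any monic polynomial of
  degree n; the squared norm of m_n is \<open>\<kappa> n\<close> times its leading
  coefficient.\<close>

definition \<kappa> :: "nat \<Rightarrow> real" where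
  "\<kappa> n = (-1) ^ n * pochhammer \<beta> n * (1 - c) powr (- (\<beta> + real n))"

text \<open>Expand m_n in (-x)_i and test against (x + \<beta>)_j: every term is an explicit moment,
  the powers depending on i cancel up to sign, and an alternating binomial sum of (\<beta> + i)_j
  remains.\<close>

lemma L_meixner_mult:
  assumes "degree g \<le> n"
  shows "L (m n * g) = \<kappa> n * coeff g n"
  using assms
proof (induction g rule: poly_rising_induct [where b = \<beta>])
  case (smult a j)
  have eq: "(1 / c - 1) ^ i * (c ^ i * (1 - c) powr (- (\<beta> + real (i + j)))) = (1 - c) powr (- (\<beta> + real j))" for i
  proof -
    have "(1 - c) powr (- (\<beta> + real (i + j))) = (1 - c) powr (- (\<beta> + real j)) / (1 - c) ^ i"
      using c by (simp add: powr_diff powr_realpow [symmetric] minus_add_distrib algebra_simps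
          powr_minus divide_simps flip: powr_add)
    moreover have "(1 / c - 1) ^ i * c ^ i = (1 - c) ^ i"
      using c by (simp add: field_simps flip: power_mult_distrib)
    ultimately have "(1 / c - 1) ^ i * (c ^ i * (1 - c) powr (- (\<beta> + real (i + j)))) =
      (1 - c) ^ i * (1 - c) powr (- (\<beta> + real j)) / (1 - c) ^ i"
      by (metis mult.assoc times_divide_eq_right)
    then show ?thesis
      using c by simp
  qed
  have "L (m n * pochhammer [:\<beta>, 1:] j) = (\<Sum>i\<le>n. pochhammer (\<beta> + real i) (n - i) / (fact i * fact (n - i)) * (1 / c - 1) ^ i *
     L (pochhammer [:0, -1:] i * pochhammer [:\<beta>, 1:] j))"
    by (simp add: meixner_def sum_distrib_right L_sum L_smult)
  also have "\<dots> = (\<Sum>i\<le>n. pochhammer \<beta> n / fact n * (1 - c) powr (- (\<beta> + real j)) *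
      (of_nat (n choose i) * (-1) ^ i * pochhammer (\<beta> + of_nat i) j))"
  proof (rule sum.cong [OF refl])
    fix i assume i: "i \<in> {..n}"
    have "L (pochhammer [:0, -1:] i * pochhammer [:\<beta>, 1:] j) =
      (-1) ^ i * pochhammer \<beta> (i + j) * c ^ i * (1 - c) powr (- (\<beta> + real (i + j)))"
      using weight_factorial_moment_sums [of i j] by (simp add: L_def poly_pochhammer sums_iff)
    then have "pochhammer (\<beta> + real i) (n - i) / (fact i * fact (n - i)) * (1 / c - 1) ^ i *
     L (pochhammer [:0, -1:] i * pochhammer [:\<beta>, 1:] j) =
      pochhammer (\<beta> + real i) (n - i) / (fact i * fact (n - i)) * ((-1) ^ i * pochhammer \<beta> (i + j)) *
       (1 - c) powr (- (\<beta> + real j))"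
      by (simp only: eq [symmetric, of i] mult_ac)
    also have "\<dots> = pochhammer \<beta> n / fact n * (1 - c) powr (- (\<beta> + real j)) *
      (of_nat (n choose i) * (-1) ^ i * pochhammer (\<beta> + of_nat i) j)"
      using i by (simp add: pochhammer_product' pochhammer_product [of i n \<beta>] binomial_fact)
    finally show "pochhammer (\<beta> + real i) (n - i) / (fact i * fact (n - i)) * (1 / c - 1) ^ i *
     L (pochhammer [:0, -1:] i * pochhammer [:\<beta>, 1:] j) = pochhammer \<beta> n / fact n * (1 - c) powr (- (\<beta> + real j)) *
      (of_nat (n choose i) * (-1) ^ i * pochhammer (\<beta> + of_nat i) j)" .
  qed
  also have "\<dots> = \<kappa> n * (if j = n then 1 else 0)"
    unfolding sum_distrib_left [symmetric] alternating_binomial_sum_pochhammer [OF smult]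
    by (simp add: \<kappa>_def)
  also have "(if j = n then 1 else 0) = coeff (pochhammer [:\<beta>, 1:] j) n"
    using smult by (simp add: coeff_pochhammer_shifted)
  finally show ?case
    by (simp add: L_smult)
next
  case (add p r)
  then show ?case
    by (simp add: distrib_left L_add)
qed

text \<open>The ratio (\<beta> + n) / (c (n + 1)) of consecutive squared norms of Meixner
  polynomials, cleared of denominators. It links the Sobolev norms to the recurrence of q.\<close>

lemma \<kappa>_lead_coeff_Suc:
  assumes l: "\<And>n. l n = (1 - 1 / c) ^ n / fact n"
  shows "(\<kappa> (Suc n) * l (Suc n)) * (c * real (Suc n)) = (\<kappa> n * l n) * (\<beta> + real n)"
proof -
  have "(1 - c) powr (- (\<beta> + real (Suc n))) = (1 - c) powr (- (\<beta> + real n)) / (1 - c)"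
  proof -
    have "- (\<beta> + real (Suc n)) = - (\<beta> + real n) - 1" by simp
    then show ?thesis
      using c powr_diff [of "1 - c" "- (\<beta> + real n)" 1] by (simp only: powr_one)
  qed
  then have "\<kappa> (Suc n) * (1 - c) = - \<kappa> n * (\<beta> + real n)"
    using c by (simp add: \<kappa>_def pochhammer_Suc)
  moreover have "l (Suc n) * (c * real (Suc n)) = - l n * (1 - c)"
    using c by (simp add: l field_simps del: of_nat_Suc)
  ultimately have "(\<kappa> (Suc n) * (1 - c)) * (l (Suc n) * (c * real (Suc n))) =
    (- \<kappa> n * (\<beta> + real n)) * (- l n * (1 - c))"
    by simp
  then show ?thesis
    using c by (simp add: mult_ac)
qed

section \<open>The Sobolev inner product on polynomials\<close>

definition sip :: "real poly \<Rightarrow> real poly \<Rightarrow> real" where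
  "sip p r = sobolev_ip \<beta> c lam (poly p) (poly r)"

lemma sip_eq: "sip p r = L (p * r) + lam * L (poly_fwd_diff p * poly_fwd_diff r)"
  by (simp add: sip_def sobolev_ip_def L_def fwd_diff_poly)

lemma sip_commute: "sip p r = sip r p"
  by (simp add: sip_eq mult.commute)

lemma sip_add_right: "sip p (r + s) = sip p r + sip p s"
  by (simp add: sip_eq distrib_left L_add poly_fwd_diff_add)

lemma sip_smult_right: "sip p (smult s r) = s * sip p r"
  by (simp add: sip_eq L_smult poly_fwd_diff_smult algebra_simps)

lemma sip_add_left: "sip (r + s) p = sip r p + sip s p"
  by (simp add: sip_commute [of _ p] sip_add_right)

lemma sip_smult_left: "sip (smult s r) p = s * sip r p"
  by (simp add: sip_commute [of _ p] sip_smult_right)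

lemma sip_diff_left: "sip (r - s) p = sip r p - sip s p"
  using sip_add_left [of "r - s" s p] by simp

lemma sip_eq_0:
  assumes "sip p p = 0"
  shows "p = 0"
proof -
  have "0 \<le> lam * L (poly_fwd_diff p * poly_fwd_diff p)"
    using lam L_square_nonneg by simp
  then have "L (p * p) = 0"
    using assms L_square_nonneg [of p] by (simp add: sip_eq)
  then show ?thesis by (rule L_square_eq_0)
qed

abbreviation R where "R \<equiv> meixner (\<beta> - 1) c"

text \<open>R_(n+1) = m_(n+1) - m_n, and its difference is a multiple of m_n. Here m_(n+1)
  annihilates g, and m_n annihilates the difference of g, whose coefficient of x^n is zero; only the
  pairing of -m_n with g survives.\<close>

lemma sip_R_Suc:
  assumes "degree g \<le> n"
  shows "sip (R (Suc n)) g = - \<kappa> n * coeff g n"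
proof -
  have "L (m (Suc n) * g) = 0" "L (m n * g) = \<kappa> n * coeff g n"
    using assms by (simp_all add: L_meixner_mult coeff_eq_0)
  moreover have "L (m n * poly_fwd_diff g) = 0"
    using assms by (simp add: L_meixner_mult degree_poly_fwd_diff coeff_poly_fwd_diff)
  moreover have "sip (R (Suc n)) g = L ((m (Suc n) - m n) * g) + lam * L (smult (1 - 1 / c) (m n) * poly_fwd_diff g)"
    by (simp only: sip_eq poly_fwd_diff_meixner) (simp only: meixner_Suc_diff)
  ultimately show ?thesis
    by (simp add: left_diff_distrib L_diff L_smult)
qed

text \<open>The cross terms vanish by orthogonality, and the norm of m_n occurs once in each half of
  the inner product, which produces the factor \<eta>.\<close>

lemma sip_R_Suc_self:
  "sip (R (Suc n)) (R (Suc n)) = \<kappa> (Suc n) * coeff (m (Suc n)) (Suc n)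
    + (1 + lam * (1 - 1 / c)\<^sup>2) * (\<kappa> n * coeff (m n) n)"
proof -
  note d = degree_lead_coeff_meixner(1) [OF c]
  have "L (m (Suc n) * m (Suc n)) = \<kappa> (Suc n) * coeff (m (Suc n)) (Suc n)"
    "L (m (Suc n) * m n) = 0" "L (m n * m n) = \<kappa> n * coeff (m n) n"
    by (simp_all add: L_meixner_mult d coeff_eq_0)
  moreover have "R (Suc n) * R (Suc n) =
      m (Suc n) * m (Suc n) + m n * m n - (m (Suc n) * m n + m (Suc n) * m n)"
    by (simp add: meixner_Suc_diff algebra_simps)
  ultimately have "L (R (Suc n) * R (Suc n)) =
      \<kappa> (Suc n) * coeff (m (Suc n)) (Suc n) + \<kappa> n * coeff (m n) n"
    by (simp only: L_diff L_add)
  moreover have "L (m n * m n) = \<kappa> n * coeff (m n) n"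
    by (simp add: L_meixner_mult d)
  moreover have "sip (R (Suc n)) (R (Suc n)) = L (R (Suc n) * R (Suc n)) +
      lam * L (smult (1 - 1 / c) (m n) * smult (1 - 1 / c) (m n))"
    by (simp only: sip_eq poly_fwd_diff_meixner)
  ultimately show ?thesis
    by (simp add: L_diff L_add L_smult power2_eq_square distrib_right mult.assoc)
qed

text \<open>Induction on the degree, removing the leading term by a multiple of S_d. The degree
  bound is conditional because the zero polynomial has degree 0; for the same reason S_0 \<noteq> 0
  is a separate hypothesis.\<close>

lemma sip_orthogonal_lower:
  assumes deg: "\<And>n. degree (S n) = n" and orth: "\<And>n k. n \<noteq> k \<Longrightarrow> sip (S n) (S k) = 0"
    and S0: "S 0 \<noteq> 0"
    and "g \<noteq> 0 \<Longrightarrow> degree g < n"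
  shows "sip (S n) g = 0"
  using assms(4)
proof (induction "degree g" arbitrary: g rule: less_induct)
  case less
  show ?case
  proof (cases "g = 0")
    case True
    then show ?thesis using sip_smult_right [of "S n" 0 0] by simp
  next
    case False
    define d where "d = degree g"
    have Sd: "coeff (S d) d \<noteq> 0"
      by (metis S0 deg degree_0 leading_coeff_0_iff)
    define h where "h = g - smult (coeff g d / coeff (S d) d) (S d)"
    have "coeff h d = 0"
      using Sd by (simp add: h_def)
    moreover have "degree h \<le> d"
      unfolding h_def using deg by (metis d_def degree_diff_le degree_smult_le order_refl)
    ultimately have "h \<noteq> 0 \<Longrightarrow> degree h < d"
      by (metis leading_coeff_0_iff le_neq_implies_less)
    moreover have "d < n" using less.prems False by (simp add: d_def)
    ultimately have "sip (S n) h = 0"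
    proof (cases "h = 0")
      case True
      then show ?thesis using sip_smult_right [of "S n" 0 0] by simp
    qed (use less.hyps [of h] d_def in auto)
    moreover have "g = h + smult (coeff g d / coeff (S d) d) (S d)"
      by (simp add: h_def)
    ultimately show ?thesis
      using orth [of n d] \<open>d < n\<close> sip_add_right sip_smult_right
      by (metis add_0 less_irrefl mult_zero_right)
  qed
qed

text \<open>Polynomials T_n are defined by the expected connection, shown to have the right leading
  coefficient and to be orthogonal to all lower degrees, and then identified with S_n. The claim is
  a telescoped form of their recursion.\<close>

lemma connection_recurrence:
  fixes S :: "nat \<Rightarrow> real poly" and q :: "nat \<Rightarrow> real" and \<eta> :: real
  assumes \<eta>: "\<eta> = 1 + lam * (1 - 1 / c)\<^sup>2"
    and deg: "\<And>n. degree (S n) = n"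
    and orth: "\<And>n k. n \<noteq> k \<Longrightarrow> sip (S n) (S k) = 0"
    and lead: "\<And>n. lead_coeff (S n) = lead_coeff (m n)"
    and q0: "q 0 = 1" and q1: "q (Suc 0) = 1"
    and rec: "\<And>n. (real (Suc n) + \<beta> - 1) * q (Suc (Suc n)) =
             (real (Suc n) + \<beta> - 1 + \<eta> * c * real (Suc n)) * q (Suc n) - c * real (Suc n) * q n"
  shows "smult (q n) (S n) = (\<Sum>k\<le>n. smult (q k) (R k))"
proof -
  define l where "l n = (1 - 1 / c) ^ n / fact n" for n
  have l0: "l n \<noteq> 0" for n
    using c by (auto simp: l_def)
  have mdeg: "degree (meixner b c n) = n" and ml: "coeff (meixner b c n) n = l n" for b n
    using degree_lead_coeff_meixner [OF c, of b n] by (simp_all add: l_def)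
  have "\<eta> > 1"
    using lam c by (simp add: \<eta>)
  \<comment> \<open>Positivity allows division by q_n. It is proved together with monotonicity,
    which keeps \<eta> q_(n+1) - q_n nonnegative.\<close>
  have qpos: "0 < q n \<and> q n \<le> q (Suc n)" for n
  proof (induction n)
    case (Suc n)
    have "(real (Suc n) + \<beta> - 1) * (q (Suc (Suc n)) - q (Suc n)) = c * real (Suc n) * (\<eta> * q (Suc n) - q n)"
      using rec [of n] by (simp add: algebra_simps del: of_nat_Suc)
    moreover have "1 * q (Suc n) \<le> \<eta> * q (Suc n)"
      using Suc \<open>\<eta> > 1\<close> by (intro mult_right_mono) auto
    with Suc have "q n \<le> \<eta> * q (Suc n)"
      by linarith
    then have "0 \<le> c * real (Suc n) * (\<eta> * q (Suc n) - q n)"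
      using c by (intro mult_nonneg_nonneg) auto
    ultimately have "0 \<le> (real (Suc n) + \<beta> - 1) * (q (Suc (Suc n)) - q (Suc n))"
      by (simp only:)
    then have "q (Suc (Suc n)) \<ge> q (Suc n)"
      using \<beta> by (auto simp: zero_le_mult_iff)
    then show ?case
      using Suc by simp
  qed (use q0 q1 in simp)
  then have qn0: "q n \<noteq> 0" for n
    by (metis less_irrefl)
  define T where "T = rec_nat 1 (\<lambda>n t. R (Suc n) + smult (q n / q (Suc n)) t)"
  have T0: "T 0 = 1" and TS: "T (Suc n) = R (Suc n) + smult (q n / q (Suc n)) (T n)" for n
    by (simp_all add: T_def)
  have Tdeg: "degree (T n) \<le> n \<and> coeff (T n) n = l n" for n
  proof (induction n)
    case (Suc n)
    then show ?case
      unfolding TS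
      by (auto simp: mdeg ml coeff_eq_0 intro!: degree_add_le order.trans [OF degree_smult_le])
  qed (simp add: T0 l_def)
  \<comment> \<open>The induction needs the exact pairing, not only orthogonality: for g = T_n it
    gives the squared norm l_n \<kappa>_n q_(n+1) / q_n.\<close>
  have TB: "sip (T n) g = coeff g n * \<kappa> n * q (Suc n) / q n" if "degree g \<le> n" for n g
    using that
  proof (induction n arbitrary: g)
    case 0
    then have "poly_fwd_diff g = 0"
      using degree_poly_fwd_diff coeff_poly_fwd_diff by (metis leading_coeff_0_iff le_zero_eq)
    then have "sip (T 0) g = L (m 0 * g) + lam * L (m 0 * 0)"
      by (simp add: sip_eq T0)
    also have "\<dots> = \<kappa> 0 * coeff g 0"
      using 0 L_meixner_mult [of g 0] L_smult [of 0 0] by simp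
    finally show ?case
      by (simp add: q0 q1)
  next
    case (Suc n)
    define s where "s = coeff g (Suc n) / l (Suc n)"
    define h where "h = g - smult s (R (Suc n))"
    have g: "g = h + smult s (R (Suc n))"
      by (simp add: h_def)
    have "coeff h (Suc n) = 0"
      using l0 by (simp add: h_def s_def ml)
    moreover have "degree h \<le> Suc n"
      unfolding h_def using Suc.prems mdeg by (metis degree_diff_le degree_smult_le)
    ultimately have hd: "degree h \<le> n"
      by (metis leading_coeff_0_iff degree_0 le_SucE zero_le)
    \<comment> \<open>The ratio q_n / q_(n+1) is chosen so that the contributions of R_(n+1) and of
      T_n cancel on degrees at most n.\<close>
    have "sip (T (Suc n)) h = - \<kappa> n * coeff h n + q n / q (Suc n) * (coeff h n * \<kappa> n * q (Suc n) / q n)"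
      using Suc.IH [OF hd] sip_R_Suc [OF hd] by (simp only: TS sip_add_left sip_smult_left)
    also have "\<dots> = 0"
      using qn0 by simp
    finally have Bh: "sip (T (Suc n)) h = 0" .
    have "sip (T n) (R (Suc n)) = - \<kappa> n * l n"
      using sip_R_Suc [of "T n" n] Tdeg [of n] sip_commute by simp
    then have "sip (T (Suc n)) (R (Suc n)) = \<kappa> (Suc n) * l (Suc n) + (\<eta> - q n / q (Suc n)) * (\<kappa> n * l n)"
      using sip_R_Suc_self [of n] by (simp add: TS sip_add_left sip_smult_left ml \<eta> algebra_simps)
    also have "\<dots> = \<kappa> (Suc n) * l (Suc n) * q (Suc (Suc n)) / q (Suc n)"
    proof -
      define H where "H = \<kappa> (Suc n) * l (Suc n)"
      have pos: "\<beta> + real n > 0"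
        using \<beta> by simp
      define K where "K = \<kappa> n * l n"
      define E where "E = c * real (Suc n)"
      define p where "p = \<beta> + real n"
      have p: "p > 0"
        using \<beta> by (simp add: p_def)
      \<comment> \<open>With H E replaced by K p, the recurrence of q multiplied by H is p times the
        required norm identity.\<close>
      have H: "H * E = K * p"
        unfolding H_def E_def K_def p_def by (rule \<kappa>_lead_coeff_Suc) (rule l_def)
      have "p * q (Suc (Suc n)) = (p + \<eta> * E) * q (Suc n) - E * q n"
        using rec [of n] by (simp add: p_def E_def mult_ac add_ac)
      then have "H * (p * q (Suc (Suc n))) = H * ((p + \<eta> * E) * q (Suc n) - E * q n)"
        by (rule arg_cong)
      then have "p * (H * q (Suc (Suc n))) = p * H * q (Suc n) + (H * E) * (\<eta> * q (Suc n) - q n)"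
        by (simp add: algebra_simps)
      also have "\<dots> = p * (H * q (Suc n) + (\<eta> * q (Suc n) - q n) * K)"
        unfolding H by (simp add: algebra_simps)
      finally have "H * q (Suc (Suc n)) = H * q (Suc n) + (\<eta> * q (Suc n) - q n) * K"
        using p by simp
      then show ?thesis
        unfolding H_def [symmetric] K_def [symmetric] using qn0 [of "Suc n"]
        by (simp add: field_simps)
    qed
    finally have "sip (T (Suc n)) g = s * (\<kappa> (Suc n) * l (Suc n) * q (Suc (Suc n)) / q (Suc n))"
      by (subst g) (simp add: sip_add_right sip_smult_right Bh)
    then show ?case
      using l0 by (simp add: s_def)
  qed
  \<comment> \<open>The difference has degree below n unless it is zero, so it is orthogonal to S_n
    and to T_n, hence to itself.\<close>
  have ST: "S n = T n" for n
  proof -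
    have "coeff (S n - T n) n = 0"
      using lead [of n] Tdeg [of n] by (simp add: deg mdeg ml)
    moreover have "degree (S n - T n) \<le> n"
      using Tdeg [of n] deg [of n] by (simp add: degree_diff_le)
    ultimately have lt: "S n - T n \<noteq> 0 \<Longrightarrow> degree (S n - T n) < n"
      by (metis leading_coeff_0_iff le_neq_implies_less)
    have "S 0 \<noteq> 0"
      using lead [of 0] by auto
    then have "sip (S n) (S n - T n) = 0"
      using sip_orthogonal_lower [OF deg orth] lt by blast
    moreover have "sip (T n) (S n - T n) = 0"
      using TB [of "S n - T n" n] \<open>coeff (S n - T n) n = 0\<close> \<open>degree (S n - T n) \<le> n\<close> by simp
    ultimately have "sip (S n - T n) (S n - T n) = 0"
      by (simp add: sip_diff_left)
    then show ?thesis
      using sip_eq_0 by fastforce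
  qed
  show ?thesis
  proof (induction n)
    case 0
    then show ?case by (simp add: ST T0)
  next
    case (Suc n)
    have "smult (q (Suc n)) (S (Suc n)) = smult (q (Suc n)) (R (Suc n)) + smult (q n) (S n)"
      using qn0 [of "Suc n"] by (simp add: ST TS smult_add_right)
    then show ?case
      by (simp add: Suc.IH)
  qed
qed

end

section \<open>Analytic continuation of the hypergeometric function\<close>

lemma slit_plane_iff: "z \<in> slit_plane \<longleftrightarrow> 1 - z \<notin> \<real>\<^sub>\<le>\<^sub>0"
proof -
  have "z \<in> complex_of_real ` {1..} \<longleftrightarrow> Im z = 0 \<and> Re z \<ge> 1"
    by (auto simp: image_iff complex_eq_iff intro!: bexI [of _ "Re z"])
  then show ?thesis
    by (auto simp: slit_plane_def complex_nonpos_Reals_iff)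
qed

lemma open_slit_plane: "open slit_plane"
proof -
  have *: "slit_plane = (\<lambda>z. 1 - z) -` (- \<real>\<^sub>\<le>\<^sub>0)"
    by (auto simp: slit_plane_iff)
  show ?thesis
    unfolding * by (intro open_vimage continuous_intros open_Compl closed_nonpos_Reals_complex)
qed

text \<open>Segments from 0 stay in the slit plane. This keeps the Euler integrand off its cut and
  yields primitives.\<close>

lemma mult_mem_slit_plane:
  assumes "z \<in> slit_plane" "0 \<le> t" "t \<le> 1"
  shows "of_real t * z \<in> slit_plane"
proof (cases "Im z = 0 \<and> Re z > 0")
  case True
  then have "t * Re z \<le> 1 * Re z"
    using assms by (intro mult_right_mono) auto
  moreover have "Re z < 1"
    using True assms(1) by (auto simp: slit_plane_iff complex_nonpos_Reals_iff)
  ultimately have "t * Re z < 1"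
    by linarith
  then show ?thesis
    by (auto simp: slit_plane_iff complex_nonpos_Reals_iff)
next
  case False
  then have "Im (of_real t * z) = 0 \<Longrightarrow> Re (of_real t * z) \<le> 0"
    using assms by (auto simp: mult_le_0_iff)
  then show ?thesis
    by (auto simp: slit_plane_iff complex_nonpos_Reals_iff)
qed

lemma starlike_slit_plane: "starlike slit_plane"
  unfolding starlike_def
proof (intro bexI ballI subsetI)
  show "0 \<in> slit_plane"
    by (simp add: slit_plane_iff)
  fix z w assume "z \<in> slit_plane" "w \<in> closed_segment 0 z"
  then show "w \<in> slit_plane"
    using mult_mem_slit_plane by (auto simp: in_segment scaleR_conv_of_real)
qed

lemma Re_less_1_imp_slit_plane: "Re z < 1 \<Longrightarrow> z \<in> slit_plane"
  by (simp add: slit_plane_iff complex_nonpos_Reals_iff)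

lemma ball_subset_slit_plane: "ball 0 1 \<subseteq> slit_plane"
proof
  fix z :: complex assume "z \<in> ball 0 1"
  then show "z \<in> slit_plane"
    using complex_Re_le_cmod [of z] by (intro Re_less_1_imp_slit_plane) simp
qed

section \<open>Analytic counterparts of the formal binomial series\<close>

lemma has_fps_expansion_powr:
  fixes g D :: complex
  shows "(\<lambda>z. (1 - g * z) powr (- D)) has_fps_expansion fps_negpow D g"
proof -
  have "((\<lambda>z. (1 + z) powr (- D)) \<circ> (\<lambda>z. - g * z)) has_fps_expansion
      (fps_binomial (- D) oo (fps_const (- g) * fps_X))"
    by (rule has_fps_expansion_compose [OF has_fps_expansion_binomial_complex
          has_fps_expansion_cmult_left [OF has_fps_expansion_fps_X]]) simp
  also have "fps_binomial (- D) oo (fps_const (- g) * fps_X) = fps_negpow D g"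
    unfolding fps_compose_linear
    by (rule fps_ext) (simp add: gbinomial_pochhammer power_minus [of g])
  finally show ?thesis
    by (simp add: o_def)
qed

lemma has_fps_expansion_geometric:
  fixes g :: complex
  shows "(\<lambda>z. inverse (1 - g * z)) has_fps_expansion fps_negpow 1 g"
proof -
  have "(1 - g * z) powr (- 1) = inverse (1 - g * z)" for z
    by (cases "1 - g * z = 0") (simp_all add: powr_minus)
  with has_fps_expansion_powr [of g 1] show ?thesis by simp
qed

text \<open>Stated through the expansion at 0, so that differentiation and primitives reduce to
  coefficient identities. Agreement with the series on the whole unit disc is recovered in
  \<open>hyp2F1_properties\<close>.\<close>

definition hyp2F1_continuable :: "complex \<Rightarrow> complex \<Rightarrow> complex \<Rightarrow> bool" where
  "hyp2F1_continuable A B C \<longleftrightarrow>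
    (\<exists>F. F holomorphic_on slit_plane \<and> F has_fps_expansion fps_hyp2F1 A B C)"

text \<open>
  Euler's integral. The bounds on the parameters make the weight continuous up to the endpoints;
  all other parameters are reached by lowering \<open>C\<close> with the operator \<open>z d/dz + C\<close> and by
  integrating, since the derivative of \<open>F(A, B; C)\<close> is a multiple of \<open>F(A + 1, B + 1; C + 1)\<close>.
\<close>

lemma hyp2F1_continuable_Euler:
  fixes A :: complex and B C :: real
  assumes B: "B > 1" and C: "C > B + 1"
  shows "hyp2F1_continuable A (of_real B) (of_real C)"
proof -
  define w where "w t = t powr (B - 1) * (1 - t) powr (C - B - 1)" for t :: real
  define f where "f z t = of_real (w t) * (1 - of_real t * z) powr (- A)" for z :: complex and t :: real
  define f' where "f' z t = of_real (w t) * (- A * (1 - of_real t * z) powr (- A - 1) * (- of_real t))" for z t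
  define I where "I z = integral {0..1} (f z)" for z
  have w_cont: "continuous_on {0..1} w"
    unfolding w_def using B C by (intro continuous_intros continuous_on_powr') auto
  have w_bound: "0 \<le> w t \<and> w t \<le> 1" if "t \<in> {0..1}" for t
    unfolding w_def using that B C
    by (auto intro!: mult_le_one powr_le1 mult_nonneg_nonneg)
  have slit: "1 - of_real t * z \<notin> \<real>\<^sub>\<le>\<^sub>0" if "z \<in> slit_plane" "t \<in> {0..1}" for z t
    using mult_mem_slit_plane [of z t] that by (simp add: slit_plane_iff)
  have pow_cont: "continuous_on (slit_plane \<times> {0..1}) (\<lambda>(z, t). (1 - complex_of_real t * z) powr s)" for s
    unfolding case_prod_beta
  proof (rule continuous_on_powr_complex)
    show "slit_plane \<times> {0..1} \<subseteq> {p. 0 \<le> Re (1 - complex_of_real (snd p) * fst p) \<or> Im (1 - complex_of_real (snd p) * fst p) \<noteq> 0}"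
      using slit by (fastforce simp: complex_nonpos_Reals_iff)
  next
    fix p assume "p \<in> slit_plane \<times> {0..1::real}" "1 - complex_of_real (snd p) * fst p = 0"
    then show "0 < Re s"
      using slit [of "fst p" "snd p"] by auto
  qed (intro continuous_intros)+
  have f_cont: "continuous_on {0..1} (f z)" if "z \<in> slit_plane" for z
  proof -
    have "continuous_on {0..1} (\<lambda>t. case (z, t) of (z, t) \<Rightarrow> (1 - complex_of_real t * z) powr (- A))"
      by (rule continuous_on_compose2 [OF pow_cont])
        (use that in \<open>auto intro!: continuous_on_Pair continuous_on_const continuous_on_id\<close>)
    then show ?thesis
      unfolding f_def case_prod_conv by (intro continuous_on_mult continuous_on_of_real w_cont)
  qed
  have I_hol: "I holomorphic_on slit_plane"
    unfolding holomorphic_on_open [OF open_slit_plane]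
  proof
    fix z assume "z \<in> slit_plane"
    then obtain r where r: "r > 0" "ball z r \<subseteq> slit_plane"
      using open_slit_plane open_contains_ball by blast
    have "(\<lambda>z. integral (cbox 0 1) (f z)) holomorphic_on ball z r"
    proof (rule leibniz_rule_holomorphic [where fx = f'])
      fix u t assume u: "u \<in> ball z r" "t \<in> cbox 0 (1::real)"
      then have "1 - of_real t * u \<notin> \<real>\<^sub>\<le>\<^sub>0"
        using slit [of u t] r by auto
      then show "((\<lambda>u. f u t) has_field_derivative f' u t) (at u within ball z r)"
        unfolding f_def f'_def
        by (auto intro!: derivative_eq_intros)
    next
      fix u assume "u \<in> ball z r"
      then show "f u integrable_on cbox 0 1"
        using r f_cont [of u] by (auto intro!: integrable_continuous_interval)
    next
      have "continuous_on (slit_plane \<times> {0..1}) (\<lambda>p. case p of (u, t) \<Rightarrow> f' u t)"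
        unfolding f'_def case_prod_beta
        by (intro continuous_intros pow_cont [unfolded case_prod_beta]
            continuous_on_compose2 [OF w_cont]) auto
      then show "continuous_on (ball z r \<times> cbox 0 1) (\<lambda>(u, t). f' u t)"
        by (rule continuous_on_subset) (use r in auto)
    qed auto
    then have "I holomorphic_on ball z r"
      unfolding I_def [abs_def] interval_cbox .
    then show "\<exists>f'. (I has_field_derivative f') (at z)"
      using r by (auto simp: holomorphic_on_open)
  qed
  \<comment> \<open>On the unit disc the binomial series of the integrand converges uniformly in t
    and is integrated termwise. The terms are Beta integrals, whose quotients supply (B)_k /
    (C)_k.\<close>
  have I_fps: "I has_fps_expansion (fps_const (of_real (Beta B (C - B))) * fps_hyp2F1 A (of_real B) (of_real C))"
    (is "_ has_fps_expansion ?F")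
  proof (rule has_fps_expansionI)
    have "eventually (\<lambda>z. z \<in> ball 0 1) (nhds (0 :: complex))"
      by (intro eventually_nhds_in_open) auto
    then show "eventually (\<lambda>z. (\<lambda>n. ?F $ n * z ^ n) sums I z) (nhds 0)"
    proof eventually_elim
      fix z :: complex assume z: "z \<in> ball 0 1"
      define h where "h k = pochhammer A k / fact k * z ^ k" for k
      have binom: "pochhammer A k / fact k * u ^ k = (- A gchoose k) * (- u) ^ k" for k u
        by (simp add: gbinomial_pochhammer power_minus [of u])
      have summable_h: "summable (\<lambda>k. norm (h k))"
      proof -
        have "summable (\<lambda>k. norm (fps_binomial (- A) $ k * (- z) ^ k))"
          using z by (intro norm_summable_fps) (simp add: fps_conv_radius_binomial)
        then show ?thesis
          by (simp only: h_def binom fps_binomial_nth)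
      qed
      have f_sums: "(\<lambda>k. of_real (w t) * (of_real t ^ k * h k)) sums f z t" if t: "t \<in> {0..1}" for t
      proof -
        have "norm (of_real t * z) \<le> 1 * norm z"
          using t unfolding norm_mult by (intro mult_right_mono) auto
        then have "norm (- (of_real t * z)) < 1"
          using z by simp
        then have "(\<lambda>k. (- A gchoose k) * (- (of_real t * z)) ^ k) sums (1 + - (of_real t * z)) powr (- A)"
          by (rule gen_binomial_complex)
        then have "(\<lambda>k. pochhammer A k / fact k * (of_real t * z) ^ k) sums (1 - of_real t * z) powr (- A)"
          by (simp only: binom add_uminus_conv_diff)
        then have "(\<lambda>k. of_real t ^ k * h k) sums (1 - of_real t * z) powr (- A)"
          by (simp add: h_def power_mult_distrib mult_ac)
        then show ?thesis
          unfolding f_def by (rule sums_mult)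
      qed
      have "uniform_limit {0..1} (\<lambda>n t. \<Sum>k<n. of_real (w t) * (of_real t ^ k * h k)) (\<lambda>t. \<Sum>k. of_real (w t) * (of_real t ^ k * h k)) sequentially"
      proof (rule Weierstrass_m_test [OF _ summable_h])
        fix k t assume t: "t \<in> {0..(1::real)}"
        then have "w t * t ^ k \<le> 1 * 1"
          using w_bound [OF t] by (intro mult_mono power_le_one) auto
        then have "\<bar>w t\<bar> * \<bar>t\<bar> ^ k * norm (h k) \<le> 1 * norm (h k)"
          using t w_bound [OF t] by (intro mult_right_mono) auto
        then show "norm (of_real (w t) * (of_real t ^ k * h k)) \<le> norm (h k)"
          by (simp add: norm_mult norm_power mult.assoc)
      qed
      then have "uniform_limit {0..1} (\<lambda>n t. \<Sum>k<n. of_real (w t) * (of_real t ^ k * h k)) (f z) sequentially"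
        by (rule uniform_limit_cong' [THEN iffD1, rotated -1]) (use f_sums in \<open>auto simp: sums_iff\<close>)
      then obtain P J where P: "\<And>n. ((\<lambda>t. \<Sum>k<n. of_real (w t) * (of_real t ^ k * h k)) has_integral P n) {0..1}"
        and J: "(f z has_integral J) {0..1}" "P \<longlonglongrightarrow> J"
        by (rule uniform_limit_integral) (auto intro!: continuous_intros w_cont)
      have "?F $ k * z ^ k = of_real (Beta (B + real k) (C - B)) * h k" for k
      proof -
        have "Beta (B + real k) (C - B) = Beta B (C - B) * pochhammer B k / pochhammer C k"
        proof -
          have G: "Gamma (x + real k) = pochhammer x k * Gamma x" if "x > 0" for x :: real
          proof -
            have "x \<notin> \<int>\<^sub>\<le>\<^sub>0"
              using that nonpos_Ints_nonpos [of x] by linarith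
            then show ?thesis
              using pochhammer_Gamma [of x k] Gamma_real_pos [OF that] by simp
          qed
          have BC: "B + real k + (C - B) = C + real k" "B + (C - B) = C" by simp_all
          show ?thesis
            unfolding Beta_def BC using B C by (simp add: G mult_ac)
        qed
        then show ?thesis
          by (simp add: h_def pochhammer_of_real mult_ac)
      qed
      moreover have "((\<lambda>t. \<Sum>k<n. of_real (w t) * (of_real t ^ k * h k)) has_integral
        (\<Sum>k<n. of_real (Beta (B + real k) (C - B)) * h k)) {0..1}" for n
      proof (rule has_integral_sum)
        fix k
        have "((\<lambda>t. t powr (B + real k - 1) * (1 - t) powr (C - B - 1)) has_integral Beta (B + real k) (C - B)) {0..1}"
          using B C by (intro has_integral_Beta_real) auto
        moreover have "t powr (B + real k - 1) * (1 - t) powr (C - B - 1) = w t * t ^ k" if "t \<in> {0..1}" for t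
        \<comment> \<open>At t = 0 both sides are 0, since \<open>0 powr r = 0\<close> for every
          exponent; this includes k = 0, where t ^ k = 1.\<close>
        proof (cases "t = 0")
          case True
          then show ?thesis
            using B by (simp add: w_def)
        next
          case False
          with that have "t powr (B + real k - 1) = t powr (B - 1) * t ^ k"
            by (simp add: powr_realpow [symmetric] powr_add [symmetric] algebra_simps)
          then show ?thesis
            by (simp add: w_def)
        qed
        ultimately have "((\<lambda>t. w t * t ^ k) has_integral Beta (B + real k) (C - B)) {0..1}"
          by (metis (no_types, lifting) has_integral_cong)
        then have "((\<lambda>t. complex_of_real (w t * t ^ k) * h k) has_integral of_real (Beta (B + real k) (C - B)) * h k) {0..1}"
          by (intro has_integral_mult_left has_integral_of_real)
        then show "((\<lambda>t. complex_of_real (w t) * (of_real t ^ k * h k)) has_integral of_real (Beta (B + real k) (C - B)) * h k) {0..1}"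
          by (simp add: mult_ac)
      qed auto
      then have "P = (\<lambda>n. \<Sum>k<n. of_real (Beta (B + real k) (C - B)) * h k)"
        using P has_integral_unique by blast
      moreover have "I z = J"
        unfolding I_def using J(1) by (rule integral_unique)
      ultimately show "(\<lambda>n. ?F $ n * z ^ n) sums I z"
        using J(2) by (simp only: sums_def)
    qed
  qed
  have nz: "Beta B (C - B) \<noteq> 0"
  proof -
    have "Gamma B > 0" "Gamma (C - B) > 0" "Gamma C > 0"
      using B C by (auto intro!: Gamma_real_pos)
    then show ?thesis
      by (simp add: Beta_def)
  qed
  let ?b = "complex_of_real (Beta B (C - B))"
  show ?thesis
    unfolding hyp2F1_continuable_def
  proof (intro exI conjI)
    show "(\<lambda>z. inverse ?b * I z) holomorphic_on slit_plane"
      by (intro holomorphic_intros I_hol)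
    have "fps_const (inverse ?b) * (fps_const ?b * f) = f" for f
      using nz by (simp flip: mult.assoc)
    with has_fps_expansion_cmult_left [OF I_fps, of "inverse ?b"]
    show "(\<lambda>z. inverse ?b * I z) has_fps_expansion fps_hyp2F1 A (of_real B) (of_real C)"
      by (simp only:)
  qed
qed

text \<open>The operator (z d/dz + C) / C multiplies the k-th coefficient by (C + k) / C, and (C +
  1)_k = (C)_k (C + k) / C.\<close>

lemma hyp2F1_continuable_lower:
  assumes C: "\<And>k. pochhammer C k \<noteq> 0" and "hyp2F1_continuable A B (C + 1)"
  shows "hyp2F1_continuable A B C"
proof -
  obtain F where F: "F holomorphic_on slit_plane" "F has_fps_expansion fps_hyp2F1 A B (C + 1)"
    using assms(2) by (auto simp: hyp2F1_continuable_def)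
  define G where "G z = inverse C * (z * deriv F z + C * F z)" for z
  have "G holomorphic_on slit_plane"
    unfolding G_def by (intro holomorphic_intros F open_slit_plane)
  moreover have "G has_fps_expansion
      fps_const (inverse C) * (fps_X * fps_deriv (fps_hyp2F1 A B (C + 1)) + fps_const C * fps_hyp2F1 A B (C + 1))"
    unfolding G_def by (intro fps_expansion_intros F)
  moreover have "fps_const (inverse C) * (fps_X * fps_deriv (fps_hyp2F1 A B (C + 1)) +
      fps_const C * fps_hyp2F1 A B (C + 1)) = fps_hyp2F1 A B C"
  proof (rule fps_ext)
    fix k
    have "C * pochhammer (C + 1) k = pochhammer C k * (C + of_nat k)"
      using pochhammer_rec [of C k] pochhammer_Suc [of C k] by simp
    moreover have C0: "C \<noteq> 0" "pochhammer C k \<noteq> 0" "C + of_nat k \<noteq> 0"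
      using C [of 1] C [of k] C [of "Suc k"] by (auto simp: pochhammer_Suc)
    ultimately have C1: "pochhammer (C + 1) k = pochhammer C k * (of_nat k + C) / C"
      by (simp add: eq_divide_eq mult_ac add.commute)
    have "inverse C * (of_nat k + C) / pochhammer (C + 1) k = 1 / pochhammer C k"
      unfolding C1 using C0 by (simp add: divide_simps add.commute)
    moreover have "u * (x / p / y) = (u / p) * (x / y)" for u p x y :: complex
      by simp
    ultimately have "inverse C * (of_nat k + C) * (x / pochhammer (C + 1) k / y) = 1 / pochhammer C k * (x / y)" for x y
      by (simp only:)
    then have "inverse C * (of_nat k + C) * (x / pochhammer (C + 1) k / y) = x / pochhammer C k / y" for x y
      by simp
    moreover have "(fps_const (inverse C) * (fps_X * fps_deriv f + fps_const C * f)) $ k =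
        inverse C * (of_nat k + C) * f $ k" for f
      by (cases k) (simp_all add: algebra_simps)
    ultimately show "(fps_const (inverse C) * (fps_X * fps_deriv (fps_hyp2F1 A B (C + 1)) +
      fps_const C * fps_hyp2F1 A B (C + 1))) $ k = fps_hyp2F1 A B C $ k"
      unfolding fps_hyp2F1_nth by (simp only: fps_hyp2F1_nth)
  qed
  ultimately show ?thesis
    by (auto simp: hyp2F1_continuable_def)
qed

text \<open>A primitive exists because the slit plane is starlike; scaling it by A B / C and fixing
  the value 1 at 0 gives the Gauss series. For C = 0 the convention x / 0 = 0 makes both the
  function and the series equal to 1.\<close>

lemma hyp2F1_continuable_primitive:
  assumes "hyp2F1_continuable (A + 1) (B + 1) (C + 1)"
  shows "hyp2F1_continuable A B C"
proof -
  obtain F where F: "F holomorphic_on slit_plane" "F has_fps_expansion fps_hyp2F1 (A + 1) (B + 1) (C + 1)"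
    using assms by (auto simp: hyp2F1_continuable_def)
  obtain G where G: "\<And>z. z \<in> slit_plane \<Longrightarrow> (G has_field_derivative F z) (at z)"
    using holomorphic_starlike_primitive [of slit_plane F "{}"] F(1) open_slit_plane starlike_slit_plane
    by (metis Diff_empty finite.emptyI holomorphic_on_imp_continuous_on holomorphic_on_imp_differentiable_at)
  have slit0: "eventually (\<lambda>z. z \<in> slit_plane) (nhds 0)"
    using open_slit_plane by (intro eventually_nhds_in_open) (auto simp: slit_plane_iff)
  have hol: "G holomorphic_on slit_plane"
    using G by (auto simp: holomorphic_on_open open_slit_plane)
  then have "G analytic_on {0}"
    using open_slit_plane slit_plane_iff by (auto simp: analytic_at)
  then have g: "G has_fps_expansion fps_expansion G 0" (is "_ has_fps_expansion ?g")
    by (rule analytic_at_imp_has_fps_expansion_0)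
  have "deriv G has_fps_expansion fps_hyp2F1 (A + 1) (B + 1) (C + 1)"
  proof (subst has_fps_expansion_cong [OF _ refl])
    show "eventually (\<lambda>z. deriv G z = F z) (nhds 0)"
      using slit0 by eventually_elim (use G DERIV_imp_deriv in blast)
  qed (rule F)
  then have dg: "fps_deriv ?g = fps_hyp2F1 (A + 1) (B + 1) (C + 1)"
    using has_fps_expansion_deriv [OF g] fps_expansion_unique_complex by blast
  define H where "H z = 1 + A * B / C * (G z - ?g $ 0)" for z
  have "H holomorphic_on slit_plane"
    unfolding H_def by (intro holomorphic_intros hol)
  moreover have "H has_fps_expansion 1 + fps_const (A * B / C) * (?g - fps_const (?g $ 0))"
    unfolding H_def by (intro fps_expansion_intros g)
  moreover have "1 + fps_const (A * B / C) * (?g - fps_const (?g $ 0)) = fps_hyp2F1 A B C"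
  proof (rule fps_ext)
    fix k
    show "(1 + fps_const (A * B / C) * (?g - fps_const (?g $ 0))) $ k = fps_hyp2F1 A B C $ k"
    proof (cases k)
      case (Suc l)
      have "of_nat (Suc l) * ?g $ (Suc l) = fps_hyp2F1 (A + 1) (B + 1) (C + 1) $ l"
        using dg [THEN arg_cong, of "\<lambda>f. f $ l"] by simp
      then have "?g $ (Suc l) = fps_hyp2F1 (A + 1) (B + 1) (C + 1) $ l / of_nat (Suc l)"
        by (simp add: field_simps del: of_nat_Suc fps_hyp2F1_nth)
      then show ?thesis
        by (simp add: Suc pochhammer_rec mult_ac)
    qed simp
  qed
  ultimately show ?thesis
    by (auto simp: hyp2F1_continuable_def)
qed

text \<open>Two inductions reduce to Euler's integral. The inner one, for B > 1, raises C until it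
  exceeds B + 1; the outer one raises all three parameters until B > 1. Both preserve the
  nonvanishing of (C)_k.\<close>

theorem hyp2F1_continuable:
  fixes A :: complex and B C :: real
  assumes C: "\<And>k. pochhammer C k \<noteq> 0"
  shows "hyp2F1_continuable A (of_real B) (of_real C)"
proof -
  have pos: "hyp2F1_continuable A (of_real B) (of_real C)"
    if "B > 1" "\<And>k. pochhammer C k \<noteq> 0" "C + real N > B + 1" for A :: complex and B C :: real and N
    using that(2,3)
  proof (induction N arbitrary: C)
    case 0
    then show ?case
      using hyp2F1_continuable_Euler \<open>B > 1\<close> by simp
  next
    case (Suc N)
    have "pochhammer (C + 1) k \<noteq> 0" for k
      using Suc.prems(1) [of "Suc k"] by (simp add: pochhammer_rec)
    then have "hyp2F1_continuable A (of_real B) (of_real (C + 1))"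
      using Suc by (intro Suc.IH) auto
    moreover have "pochhammer (of_real C :: complex) k \<noteq> 0" for k
      using Suc.prems(1) [of k] by (simp add: pochhammer_of_real)
    ultimately show ?case
      using hyp2F1_continuable_lower [of "of_real C" A "of_real B"] by simp
  qed
  obtain N where "1 - B < real N"
    using reals_Archimedean2 by blast
  then show ?thesis
    using C
  proof (induction N arbitrary: A B C)
    case 0
    obtain M where "B + 1 - C < real M"
      using reals_Archimedean2 by blast
    then show ?case
      using 0 by (intro pos [where N = M]) auto
  next
    case (Suc N)
    have "pochhammer (C + 1) k \<noteq> 0" for k
      using Suc.prems(2) [of "Suc k"] by (simp add: pochhammer_rec)
    then have "hyp2F1_continuable (A + 1) (of_real (B + 1)) (of_real (C + 1))"
      using Suc.prems by (intro Suc.IH) auto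
    then show ?case
      using hyp2F1_continuable_primitive [of A "of_real B" "of_real C"] by simp
  qed
qed

text \<open>A continuation witnesses the choice in the definition of \<open>hyp2F1\<close>: being
  holomorphic on the unit disc, it equals Gauss' series there.\<close>

lemma hyp2F1_properties:
  assumes "hyp2F1_continuable A B C"
  shows hyp2F1_holomorphic: "hyp2F1 A B C holomorphic_on slit_plane"
    and hyp2F1_has_fps_expansion: "hyp2F1 A B C has_fps_expansion fps_hyp2F1 A B C"
proof -
  obtain F where F: "F holomorphic_on slit_plane" "F has_fps_expansion fps_hyp2F1 A B C"
    using assms by (auto simp: hyp2F1_continuable_def)
  have series: "F z = hyp2F1_series A B C z" if "norm z < 1" for z
  proof -
    have "F holomorphic_on eball 0 (ereal 1)"
      unfolding eball_ereal by (rule holomorphic_on_subset [OF F(1) ball_subset_slit_plane])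
    then have "(\<lambda>n. fps_hyp2F1 A B C $ n * z ^ n) sums F z"
      using that F(2) by (intro has_fps_expansion_imp_sums_complex [where r = "ereal 1"]) auto
    then show ?thesis
      by (simp add: hyp2F1_series_def sums_iff mult_ac)
  qed
  have *: "hyp2F1 A B C holomorphic_on slit_plane \<and> (\<forall>z. norm z < 1 \<longrightarrow> hyp2F1 A B C z = hyp2F1_series A B C z)"
    unfolding hyp2F1_def by (rule someI [where x = F]) (use F series in auto)
  then show "hyp2F1 A B C holomorphic_on slit_plane" ..
  have "eventually (\<lambda>z. z \<in> ball 0 1) (nhds (0 :: complex))"
    by (intro eventually_nhds_in_open) auto
  then have "eventually (\<lambda>z. hyp2F1 A B C z = F z) (nhds 0)"
    by eventually_elim (use * series in auto)
  from has_fps_expansion_cong [OF this refl] F(2)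
  show "hyp2F1 A B C has_fps_expansion fps_hyp2F1 A B C"
    by blast
qed

section \<open>The generating function\<close>

abbreviation (input) cpoly :: "real poly \<Rightarrow> complex poly" where
  "cpoly \<equiv> map_poly of_real"

lemma cpoly_add: "cpoly (p + r) = cpoly p + cpoly r"
  by (rule poly_eqI) (simp add: coeff_map_poly)

lemma cpoly_smult: "cpoly (smult s p) = smult (of_real s) (cpoly p)"
  by (rule poly_eqI) (simp add: coeff_map_poly)

lemma cpoly_mult: "cpoly (p * r) = cpoly p * cpoly r"
  by (rule poly_eqI) (simp add: coeff_map_poly coeff_mult)

lemma cpoly_sum: "cpoly (sum f I) = (\<Sum>i\<in>I. cpoly (f i))"
  by (induction I rule: infinite_finite_induct) (simp_all add: cpoly_add)

lemma poly_cpoly_pochhammer_neg_X: "poly (cpoly (pochhammer [:0, -1:] k)) x = pochhammer (- x) k"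
proof (induction k)
  case (Suc k)
  have "[:0, -1:] + of_nat k = ([:real k, -1:] :: real poly)"
    by (simp add: of_nat_poly)
  with Suc show ?case
    by (simp add: pochhammer_Suc cpoly_mult map_poly_pCons del: mult_pCons_right mult_pCons_left)
qed simp

text \<open>Since (\<beta> + k)_(n - k) = (\<beta>)_n / (\<beta>)_k, the factor (\<beta>)_n / n!
  comes out, the one that relates q_n to the coefficients of P. What remains is the binomial sum of
  \<open>formal_generating_function\<close>.\<close>

lemma poly_cpoly_meixner:
  assumes "\<And>k. pochhammer \<beta> k \<noteq> 0"
  shows "poly (cpoly (meixner \<beta> c n)) x = pochhammer (of_real \<beta>) n / fact n *
    (\<Sum>k\<le>n. of_nat (n choose k) * (pochhammer (- x) k / pochhammer (of_real \<beta>) k * of_real (1 / c - 1) ^ k))"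
proof -
  have "poly (cpoly (meixner \<beta> c n)) x = (\<Sum>k\<le>n. of_real (pochhammer (\<beta> + real k) (n - k) /
    (fact k * fact (n - k)) * (1 / c - 1) ^ k) * pochhammer (- x) k)"
    by (simp only: meixner_def cpoly_sum cpoly_smult poly_sum poly_smult poly_cpoly_pochhammer_neg_X)
  also have "\<dots> = (\<Sum>k\<le>n. pochhammer (of_real \<beta>) n / fact n *
    (of_nat (n choose k) * (pochhammer (- x) k / pochhammer (of_real \<beta>) k * of_real (1 / c - 1) ^ k)))"
  proof (rule sum.cong [OF refl])
    fix k assume k: "k \<in> {..n}"
    have "pochhammer (\<beta> + real k) (n - k) = pochhammer \<beta> n / pochhammer \<beta> k"
      using k pochhammer_product [of k n \<beta>] assms [of k] by simp
    then have "pochhammer (\<beta> + real k) (n - k) / (fact k * fact (n - k)) * (1 / c - 1) ^ k =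
      pochhammer \<beta> n / fact n * (of_nat (n choose k) / pochhammer \<beta> k * (1 / c - 1) ^ k)"
      using k by (simp add: binomial_fact)
    then have "complex_of_real (pochhammer (\<beta> + real k) (n - k) / (fact k * fact (n - k)) * (1 / c - 1) ^ k) =
      of_real (pochhammer \<beta> n / fact n * (of_nat (n choose k) / pochhammer \<beta> k * (1 / c - 1) ^ k))"
      by (rule arg_cong)
    also have "\<dots> = pochhammer (of_real \<beta>) n / fact n *
      (of_nat (n choose k) / pochhammer (of_real \<beta>) k * of_real (1 / c - 1) ^ k)"
      by (simp add: pochhammer_of_real)
    finally show "of_real (pochhammer (\<beta> + real k) (n - k) / (fact k * fact (n - k)) * (1 / c - 1) ^ k) * pochhammer (- x) k =
      pochhammer (of_real \<beta>) n / fact n * (of_nat (n choose k) *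
        (pochhammer (- x) k / pochhammer (of_real \<beta>) k * of_real (1 / c - 1) ^ k))"
      by (simp add: mult_ac)
  qed
  finally show ?thesis
    by (simp add: sum_distrib_left)
qed

text \<open>The quadratic c t^2 - (1 + \<eta> c) t + 1 has value 1 at 0 and c (1 - \<eta>) < 0 at 1,
  so its smaller root lies strictly between 0 and 1.\<close>

lemma smaller_root_properties:
  fixes a c \<eta> :: real
  assumes c: "0 < c" "c < 1" and \<eta>: "\<eta> > 1"
    and a: "a = (1 + \<eta> * c - sqrt ((1 + \<eta> * c)\<^sup>2 - 4 * c)) / (2 * c)"
  shows "0 < a" "a < 1" "c * a\<^sup>2 + 1 = (1 + \<eta> * c) * a"
proof -
  define b where "b = 1 + \<eta> * c"
  define s where "s = sqrt (b\<^sup>2 - 4 * c)"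
  have b: "b > 1 + c"
    using c \<eta> by (simp add: b_def)
  have "(b - 2 * c)\<^sup>2 < b\<^sup>2 - 4 * c"
  proof -
    have "0 < 4 * c * (b - (1 + c))"
      using b c by simp
    then show ?thesis
      by (simp add: power2_eq_square algebra_simps)
  qed
  then have s1: "\<bar>b - 2 * c\<bar> < s"
    unfolding s_def by (metis real_sqrt_abs real_sqrt_less_iff)
  have d0: "0 \<le> b\<^sup>2 - 4 * c"
    using \<open>(b - 2 * c)\<^sup>2 < b\<^sup>2 - 4 * c\<close> zero_le_power2 [of "b - 2 * c"] by linarith
  have "s < sqrt (b\<^sup>2)"
    unfolding s_def using c by (intro real_sqrt_less_mono) simp
  then have s2: "s < b"
    using b c by simp
  have a': "a * (2 * c) = b - s"
    using a c by (simp add: b_def s_def)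
  show "0 < a"
    using a' s2 c by (metis diff_gt_0_iff_gt mult_pos_pos zero_less_mult_pos2 zero_less_numeral)
  have "a * (2 * c) < 1 * (2 * c)"
    using a' s1 by linarith
  then show "a < 1"
    using c by simp
  have "s\<^sup>2 = b\<^sup>2 - 4 * c"
    using d0 by (simp add: s_def)
  moreover have "s = b - a * (2 * c)"
    using a' by simp
  ultimately have "(4 * c) * (c * a\<^sup>2 + 1) = (4 * c) * (b * a)"
    by (simp add: power2_eq_square algebra_simps)
  then show "c * a\<^sup>2 + 1 = (1 + \<eta> * c) * a"
    using c by (simp add: b_def)
qed

section \<open>Real parts of quotients of linear factors on a disc\<close>

lemma Re_one_minus_pos:
  fixes w :: complex
  assumes "0 \<le> t" "t * norm w < 1"
  shows "0 < Re (1 - of_real t * w)"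
proof -
  have "t * Re w \<le> t * norm w"
    using assms complex_Re_le_cmod by (intro mult_left_mono) auto
  with assms show ?thesis by simp
qed

lemma one_minus_not_nonpos:
  fixes w :: complex
  assumes "0 \<le> t" "t * norm w < 1"
  shows "1 - of_real t * w \<notin> \<real>\<^sub>\<le>\<^sub>0"
  using Re_one_minus_pos [OF assms] by (auto simp: complex_nonpos_Reals_iff)

text \<open>For numerator p and denominator q the sign is that of Re p Re q + Im p Im q, where Im p
  Im q = s t (Im w)^2 is nonnegative.\<close>

lemma Re_one_minus_quotient_pos:
  fixes w :: complex
  assumes "0 \<le> s" "0 \<le> t" "s * norm w < 1" "t * norm w < 1"
  shows "0 < Re ((1 - of_real s * w) / (1 - of_real t * w))"
proof -
  have "0 < Re (1 - of_real s * w) * Re (1 - of_real t * w)"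
    using assms by (intro mult_pos_pos Re_one_minus_pos)
  moreover have "0 \<le> (s * t) * (Im w)\<^sup>2"
    using assms by simp
  ultimately have "0 < Re (1 - of_real s * w) * Re (1 - of_real t * w) + Im (1 - of_real s * w) * Im (1 - of_real t * w)"
    by (simp add: power2_eq_square mult_ac)
  moreover have "1 - of_real t * w \<noteq> 0"
    using Re_one_minus_pos [of t w] assms by (metis less_irrefl zero_complex.simps(1))
  ultimately show ?thesis
    unfolding Re_divide cmod_power2 [symmetric] by (intro divide_pos_pos) simp_all
qed

lemma Im_one_minus_quotient:
  "Im ((1 - of_real s * w) / (1 - of_real t * w)) = (t - s) * Im w / (norm (1 - of_real t * w))\<^sup>2"
  unfolding Im_divide cmod_power2 by (simp add: algebra_simps)

(* The two quotients have positive real parts and imaginary parts of opposite signs. *)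
lemma Re_one_minus_double_quotient_pos:
  fixes w :: complex
  assumes "0 \<le> t1" "t1 \<le> s1" "0 \<le> s2" "s2 \<le> t2" "s1 * norm w < 1" "t2 * norm w < 1"
  shows "0 < Re ((1 - of_real s1 * w) / (1 - of_real t1 * w) * ((1 - of_real s2 * w) / (1 - of_real t2 * w)))"
    (is "0 < Re (?p * ?q)")
proof -
  have "t1 * norm w < 1" "s2 * norm w < 1"
    using assms mult_right_mono [of t1 s1 "norm w"] mult_right_mono [of s2 t2 "norm w"] by auto
  then have "0 < Re ?p * Re ?q"
    using assms by (intro mult_pos_pos Re_one_minus_quotient_pos) auto
  moreover have "Im ?p * Im ?q = - ((s1 - t1) * (t2 - s2) * (Im w)\<^sup>2 /
      ((norm (1 - of_real t1 * w))\<^sup>2 * (norm (1 - of_real t2 * w))\<^sup>2))"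
    unfolding Im_one_minus_quotient by (simp add: power2_eq_square algebra_simps add_divide_distrib diff_divide_distrib)
  moreover have "0 \<le> (s1 - t1) * (t2 - s2) * (Im w)\<^sup>2 /
      ((norm (1 - of_real t1 * w))\<^sup>2 * (norm (1 - of_real t2 * w))\<^sup>2)"
    using assms by simp
  ultimately show ?thesis
    unfolding times_complex.sel by linarith
qed

theorem theorem4p3:
  fixes \<beta> c lam \<eta> a \<gamma> \<delta> :: real
    and S :: "nat \<Rightarrow> real poly"
    and q :: "nat \<Rightarrow> real"
  assumes "\<beta> > 0" and "\<beta> \<noteq> 1" and "0 < c" and "c < 1" and "lam > 0"
    and "\<eta> = 1 + lam * (1 - 1 / c)\<^sup>2"
    and "\<And>n. degree (S n) = n"
    and "\<And>n m. n \<noteq> m \<Longrightarrow> sobolev_ip \<beta> c lam (poly (S n)) (poly (S m)) = 0"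
    and "\<And>n. lead_coeff (S n) = lead_coeff (meixner \<beta> c n)"
    and "q 0 = 1" and "q 1 = 1"
    and "\<And>n. n \<ge> 1 \<Longrightarrow>
           (real n + \<beta> - 1) * q (n + 1) =
             (real n + \<beta> - 1 + \<eta> * c * real n) * q n - c * real n * q (n - 1)"
    and "a = (1 + \<eta> * c - sqrt ((1 + \<eta> * c)\<^sup>2 - 4 * c)) / (2 * c)"
    and "\<gamma> = (a - a\<^sup>2 * c) / (1 - a\<^sup>2 * c)"
    and "\<delta> = (1 - a) / (1 - a\<^sup>2 * c)"
  shows "a * c < 1 \<and>
    (\<forall>(x :: complex) (\<omega> :: complex). norm \<omega> < a * c \<longrightarrow>
      (\<lambda>n. of_real (q n) * poly (map_poly of_real (S n)) x * \<omega> ^ n) sums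
        (1 / (1 - \<omega>)
         * (1 - of_real c * of_real a * \<omega>) powr (- ((of_real \<beta> - 1) * of_real \<delta>))
         * (1 - \<omega> / of_real a) powr (- ((of_real \<beta> - 1) * of_real \<gamma>))
         * (1 - \<omega> / (of_real a * of_real c)) powr x
         * (1 - \<omega> / of_real a) powr (- x)
         * hyp2F1 (- x) ((of_real \<beta> - 1) * of_real \<delta>) (of_real \<beta> - 1)
             (\<omega> * (of_real c - 1) * (1 - (of_real a)\<^sup>2 * of_real c)
               / ((1 - of_real c * of_real a * \<omega>) * (of_real a * of_real c - \<omega>)))))"
proof -
  interpret meixner_sobolev \<beta> c lam
    by unfold_locales fact+
  have \<eta>1: "\<eta> > 1"
    using assms(3-6) by simp
  note root = smaller_root_properties [OF assms(3,4) \<eta>1 assms(13)]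
  have ac: "a * c < 1"
    using root(1,2) assms(3,4) mult_strict_mono [of a 1 c 1] by simp
  have acpos: "a * c > 0"
    using root(1) assms(3) by simp
  have aac: "a\<^sup>2 * c < 1"
    using root(1,2) ac mult_strict_mono [of a 1 "a * c" 1] acpos by (simp add: power2_eq_square mult_ac)
  define C where "C = \<beta> - 1"
  \<comment> \<open>Here \<beta> > 0 rules out integers C at most -1, and \<beta> \<noteq> 1 rules
    out C = 0.\<close>
  have C0: "pochhammer C k \<noteq> 0" for k
  proof
    assume "pochhammer C k = 0"
    then obtain i where "C = - real i"
      by (auto simp: pochhammer_eq_0_iff)
    with assms(1,2) show False
      by (cases i) (auto simp: C_def)
  qed
  \<comment> \<open>Multiplied by \<beta> - 1, these become the conditions A + B = C and A \<alpha>
    + B b = C on the exponents of P.\<close>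
  have gd: "\<gamma> + \<delta> = 1" "\<gamma> / a + \<delta> * (a * c) = 1"
  proof -
    show "\<gamma> + \<delta> = 1"
      using aac by (simp add: assms(14,15) add_divide_distrib [symmetric])
    have "\<gamma> / a = (1 - a * c) / (1 - a\<^sup>2 * c)"
    proof -
      have "a - a\<^sup>2 * c = a * (1 - a * c)"
        by (simp add: power2_eq_square algebra_simps)
      then show ?thesis
        using root(1) by (simp add: assms(14))
    qed
    then have "\<gamma> / a + \<delta> * (a * c) = ((1 - a * c) + (1 - a) * (a * c)) / (1 - a\<^sup>2 * c)"
      by (simp add: assms(15) add_divide_distrib)
    then show "\<gamma> / a + \<delta> * (a * c) = 1"
      using aac by (simp add: power2_eq_square algebra_simps)
  qed
  \<comment> \<open>The quadratic equation divided by a; it says (1 - t/a) (1 - a c t) = 1 - (1 +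
    \<eta> c) t + c t^2.\<close>
  have \<alpha>b: "1 / a + a * c = 1 + \<eta> * c"
    using root by (simp add: power2_eq_square field_simps)
  have sums: "(\<lambda>n. of_real (q n) * poly (cpoly (S n)) x * \<omega> ^ n) sums
        (1 / (1 - \<omega>)
         * (1 - of_real c * of_real a * \<omega>) powr (- ((of_real \<beta> - 1) * of_real \<delta>))
         * (1 - \<omega> / of_real a) powr (- ((of_real \<beta> - 1) * of_real \<gamma>))
         * (1 - \<omega> / (of_real a * of_real c)) powr x
         * (1 - \<omega> / of_real a) powr (- x)
         * hyp2F1 (- x) ((of_real \<beta> - 1) * of_real \<delta>) (of_real \<beta> - 1)
             (\<omega> * (of_real c - 1) * (1 - (of_real a)\<^sup>2 * of_real c)
               / ((1 - of_real c * of_real a * \<omega>) * (of_real a * of_real c - \<omega>))))" (is "?s sums ?G \<omega>")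
    if \<omega>: "norm \<omega> < a * c" for x \<omega> :: complex
  proof -
    \<comment> \<open>\<alpha> and b are the reciprocals of the points where the factors of P
      degenerate, and g = \<alpha> (1 + \<kappa>') is the reciprocal of the radius a c.\<close>
    define \<alpha> b g \<kappa>' :: real where "\<alpha> = 1 / a" and "b = a * c" and "g = 1 / (a * c)" and "\<kappa>' = 1 / c - 1"
    define A B :: real where "A = C * \<gamma>" and "B = C * \<delta>"
    define P where "P = fps_negpow (complex_of_real A) (of_real \<alpha>) * fps_negpow (of_real B) (of_real b)"
    define Zf where "Zf = fps_const (complex_of_real (\<kappa>' * (b - \<alpha>))) * fps_X * fps_negpow 1 (of_real b) * fps_negpow 1 (of_real g)"
    define Gf where "Gf = fps_negpow 1 1 * (fps_negpow (of_real B) (of_real b) * fps_negpow (of_real A - (- x)) (of_real \<alpha>)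
      * fps_negpow (- x) (of_real g) * (fps_hyp2F1 (- x) (of_real B) (of_real C) oo Zf))"
    define Z where "Z \<omega> = \<omega> * (of_real c - 1) * (1 - (of_real a)\<^sup>2 * of_real c)
               / ((1 - of_real c * of_real a * \<omega>) * (of_real a * of_real c - \<omega>))" for \<omega> :: complex
    have params: "A + B = C" "A * \<alpha> + B * b = C" "\<alpha> + b = 1 + \<eta> * c" "\<alpha> * b = c" "g = \<alpha> + \<alpha> * \<kappa>'"
      using gd \<alpha>b root(1) assms(3)
      by (simp_all add: A_def B_def \<alpha>_def b_def g_def \<kappa>'_def field_simps flip: distrib_left)
    have cont: "hyp2F1_continuable (- x) (of_real B) (of_real C)"
      using C0 by (rule hyp2F1_continuable)
    have g: "1 \<le> g" "b \<le> a" "a \<le> g" "\<alpha> \<le> g" "b \<le> g" "0 < b" "0 < \<alpha>"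
    proof -
      show "1 \<le> g" "b \<le> a" "0 < b" "0 < \<alpha>"
        using ac acpos root(1) assms(4) by (simp_all add: g_def b_def \<alpha>_def)
      then show "a \<le> g" "b \<le> g"
        using root(2) by simp_all
      show "\<alpha> \<le> g"
        unfolding \<alpha>_def g_def using root(1) acpos assms(4) by (intro divide_left_mono) simp_all
    qed
    have tz: "t * norm z < 1" if "norm z < a * c" "t \<le> g" for t and z :: complex
    proof -
      have "t * norm z \<le> g * norm z"
        using that by (intro mult_right_mono) auto
      also have "\<dots> < g * (a * c)"
        using that g by (intro mult_strict_left_mono) auto
      finally show ?thesis
        using root(1) assms(3) by (simp add: g_def)
    qed
    have not_nonpos: "1 - of_real t * z \<notin> \<real>\<^sub>\<le>\<^sub>0" if "norm z < a * c" "0 \<le> t" "t \<le> g" for t and z :: complex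
      using that tz by (intro one_minus_not_nonpos) auto
    define Y where "Y z = of_real (\<kappa>' * (b - \<alpha>)) * z * inverse (1 - of_real b * z) * inverse (1 - of_real g * z)" for z :: complex
    have ZY: "Z z = Y z" for z
    proof -
      have "of_real a * of_real c - z = of_real (a * c) * (1 - of_real g * z)"
        using root(1) assms(3) by (simp add: g_def field_simps)
      moreover have "\<kappa>' * (b - \<alpha>) = (c - 1) * (1 - a\<^sup>2 * c) / (a * c)"
        using root(1) assms(3) by (simp add: \<kappa>'_def b_def \<alpha>_def power2_eq_square field_simps)
      ultimately show ?thesis
        by (simp add: Z_def Y_def b_def divide_inverse mult_ac)
    qed
    have Y_fps: "Y has_fps_expansion Zf"
      unfolding Y_def [abs_def] Zf_def
      by (intro has_fps_expansion_mult has_fps_expansion_geometric has_fps_expansion_const has_fps_expansion_fps_X)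
    have Y_hol: "Y holomorphic_on ball 0 (a * c)"
      unfolding Y_def [abs_def]
      using not_nonpos [of _ b] not_nonpos [of _ g] g
      by (intro holomorphic_intros) fastforce+
    have Y_slit: "Y z \<in> slit_plane" if z: "norm z < a * c" for z
    proof -
      have nz: "1 - of_real t * z \<noteq> 0" if "0 \<le> t" "t \<le> g" for t
        using not_nonpos [OF z that] by auto
      \<comment> \<open>These relations factor the numerator of 1 - Y: b g = a \<alpha> = 1 matches
        the quadratic terms, the sum the linear ones. Then 1 - Y is a product of two quotients, and
        b \<le> a and \<alpha> \<le> g give it positive real part.\<close>
      have sum: "b + g + \<kappa>' * (b - \<alpha>) = a + \<alpha>" and prod: "b * g = 1" "a * \<alpha> = 1"
        using root(1) assms(3) by (simp_all add: b_def g_def \<kappa>'_def \<alpha>_def field_simps)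
      have "(1 - of_real b * z) * (1 - of_real g * z) - of_real (\<kappa>' * (b - \<alpha>)) * z =
        1 - of_real (b + g + \<kappa>' * (b - \<alpha>)) * z + of_real (b * g) * z\<^sup>2"
        by (simp add: power2_eq_square algebra_simps)
      also have "\<dots> = 1 - of_real (a + \<alpha>) * z + of_real (a * \<alpha>) * z\<^sup>2"
        by (simp only: sum prod)
      also have "\<dots> = (1 - of_real a * z) * (1 - of_real \<alpha> * z)"
        by (simp add: power2_eq_square algebra_simps)
      finally have "1 - Y z = (1 - of_real a * z) / (1 - of_real b * z) * ((1 - of_real \<alpha> * z) / (1 - of_real g * z))"
        using nz [of b] nz [of g] g by (simp add: Y_def divide_simps)
      moreover have "0 < Re ((1 - of_real a * z) / (1 - of_real b * z) * ((1 - of_real \<alpha> * z) / (1 - of_real g * z)))"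
        using g tz [OF z] by (intro Re_one_minus_double_quotient_pos) auto
      ultimately have "0 < Re (1 - Y z)"
        by (simp only:)
      then show ?thesis
        by (intro Re_less_1_imp_slit_plane) simp
    qed
    define h where "h = hyp2F1 (- x) (of_real B) (of_real C)"
    have G_eq: "?G = (\<lambda>z. inverse (1 - 1 * z) * ((1 - of_real b * z) powr (- of_real B) *
      ((1 - of_real \<alpha> * z) powr (- of_real A) * (1 - of_real \<alpha> * z) powr (- x)) *
      (1 - of_real g * z) powr (- (- x)) * (h \<circ> Y) z))"
      unfolding o_def ZY [symmetric] h_def
      by (rule ext) (simp add: Z_def A_def B_def C_def \<alpha>_def b_def g_def divide_inverse mult_ac)
    have G_fps: "?G has_fps_expansion Gf"
    proof -
      have "fps_negpow (of_real A - (- x)) (of_real \<alpha>) = fps_negpow (of_real A) (of_real \<alpha>) * fps_negpow x (of_real \<alpha>)"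
        by (simp add: fps_negpow_add)
      moreover have "(h \<circ> Y) has_fps_expansion (fps_hyp2F1 (- x) (of_real B) (of_real C) oo Zf)"
        unfolding h_def
        by (intro has_fps_expansion_compose hyp2F1_has_fps_expansion cont Y_fps) (simp add: Zf_def)
      ultimately show ?thesis
        unfolding G_eq Gf_def
        by (simp only:) (intro has_fps_expansion_mult has_fps_expansion_geometric has_fps_expansion_powr)
    qed
    have G_hol: "?G holomorphic_on ball 0 (a * c)"
      unfolding G_eq
    proof (intro holomorphic_on_mult)
      show "(h \<circ> Y) holomorphic_on ball 0 (a * c)"
        unfolding h_def
        by (rule holomorphic_on_compose_gen [OF Y_hol hyp2F1_holomorphic [OF cont]]) (auto intro: Y_slit)
      show "(\<lambda>z. inverse (1 - 1 * z)) holomorphic_on ball 0 (a * c)"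
      proof (intro holomorphic_intros)
        fix z :: complex assume "z \<in> ball 0 (a * c)"
        then show "1 - 1 * z \<noteq> 0"
          using not_nonpos [of z 1] g by auto
      qed
    qed (use not_nonpos g in \<open>auto intro!: holomorphic_intros\<close>)
    have q_rec: "(real (Suc n) + C) * q (Suc (Suc n)) =
      (C + (\<alpha> + b) * real (Suc n)) * q (Suc n) - \<alpha> * b * real (Suc n) * q n" for n
      using assms(12) [of "Suc n"] by (simp add: C_def params algebra_simps)
    have P_nth: "P $ n = pochhammer (of_real C) n / fact n * of_real (q n)" for n
      unfolding P_def
    proof (rule negpow_product_coeff)
      show "of_real A * of_real \<alpha> + of_real B * of_real b = complex_of_real C"
        "of_real A + of_real B = complex_of_real C"
        using params(1,2) by (simp_all only: flip: of_real_mult of_real_add)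
      show "complex_of_real (q 0) = 1" "complex_of_real (q (Suc 0)) = 1"
        using assms(10,11) by simp_all
      fix n
      show "(of_nat (Suc n) + of_real C) * complex_of_real (q (Suc (Suc n))) =
        (of_real C + (of_real \<alpha> + of_real b) * of_nat (Suc n)) * of_real (q (Suc n)) -
          of_real \<alpha> * of_real b * of_nat (Suc n) * of_real (q n)"
        using arg_cong [OF q_rec [of n], of complex_of_real] by (simp del: of_nat_Suc)
    qed
    have conn: "smult (q n) (S n) = (\<Sum>k\<le>n. smult (q k) (R k))" for n
    proof (rule connection_recurrence)
      show "sip (S n) (S k) = 0" if "n \<noteq> k" for n k
        using assms(8) [OF that] by (simp add: sip_def)
      fix n
      show "(real (Suc n) + \<beta> - 1) * q (Suc (Suc n)) =
             (real (Suc n) + \<beta> - 1 + \<eta> * c * real (Suc n)) * q (Suc n) - c * real (Suc n) * q n"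
        using assms(12) [of "Suc n"] by simp
    qed (use assms in auto)
    have coeffs: "Gf $ n = of_real (q n) * poly (cpoly (S n)) x" for n
    proof -
      define H where "H = Abs_fps (\<lambda>n. (\<Sum>k\<le>n. of_nat (n choose k) *
        (pochhammer (- x) k / pochhammer (of_real C) k * of_real \<kappa>' ^ k)) * P $ n)"
      have "pochhammer (complex_of_real C) k \<noteq> 0" for k
        using C0 [of k] by (simp add: pochhammer_of_real)
      moreover have "of_real A + of_real B = complex_of_real C"
        using params(1) by (simp flip: of_real_add)
      ultimately have "H = fps_negpow (of_real B) (of_real b) * fps_negpow (of_real A - (- x)) (of_real \<alpha>)
          * fps_negpow (- x) (of_real \<alpha> + of_real \<alpha> * of_real \<kappa>') * (fps_hyp2F1 (- x) (of_real B) (of_real C) oo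
        (fps_const (of_real \<kappa>' * (of_real b - of_real \<alpha>)) * fps_X * fps_negpow 1 (of_real b) * fps_negpow 1 (of_real \<alpha> + of_real \<alpha> * of_real \<kappa>')))"
        unfolding H_def P_def by (rule formal_generating_function)
      then have "Gf = fps_negpow 1 1 * H"
        by (simp add: Gf_def Zf_def params)
      \<comment> \<open>Multiplication by 1 / (1 - X) sums the coefficients of H; the k-th one is
        q_k R_k(x), so \<open>conn\<close> collapses the sum.\<close>
      then have "Gf $ n = (\<Sum>k\<le>n. H $ k)"
        by (simp add: mult.commute [of _ H] fps_mult_nth atLeast0AtMost pochhammer_fact [symmetric])
      also have "\<dots> = (\<Sum>k\<le>n. of_real (q k) * poly (cpoly (R k)) x)"
        using poly_cpoly_meixner [OF C0, of c _ x]
        by (simp add: H_def P_nth C_def \<kappa>'_def mult_ac)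
      also have "\<dots> = poly (cpoly (smult (q n) (S n))) x"
        by (simp add: conn cpoly_sum cpoly_smult poly_sum)
      finally show ?thesis
        by (simp add: cpoly_smult)
    qed
    \<comment> \<open>The expansion is known only near 0; holomorphy of the closed form on the disc
      of radius a c extends it to every admissible \<omega>.\<close>
    have "(\<lambda>n. Gf $ n * \<omega> ^ n) sums ?G \<omega>"
      using G_fps G_hol \<omega> by (intro has_fps_expansion_imp_sums_complex [where r = "ereal (a * c)"]) auto
    then show ?thesis
      by (simp only: coeffs)
  qed
  with ac show ?thesis by blast
qed

end
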